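(* Let $K$ be a division ring and $G$ a group. Every $G$-lattice $L$ over $K$ determines an extension of $K$ by $G$ which is unique up to equivalence of factor systems (that is, there is an extension determined by $L$, and any two factor systems whose extensions are determined by $L$ are equivalent). Conversely, if $H=H(\chi,[\cdot,\cdot])$ is an extension of $K$ by $G$, then there is a $G$-lattice $L$ over $K$ such that $H$ is determined by $L$.
   Context: Modules are left modules over $K$; $K^*=K\setminus\{0\}$. A semilinear transformation of a $K$-module $V$ is an additive map $f:V\to V$ with a ring automorphism $\theta_f$ of $K$ such that $f(\alpha v)=\theta_f(\alpha)f(v)$. $SGL(V)$ is the group of bijective semilinear transformations of $V$. A representation of $G$ over $K$ is a map $\rho:G\to SGL(V)$ such that for all $g,h\in G$ there is a scalar $\alpha(g,h)\in K^*$ with $\rho(g)\rho(h)=\alpha(g,h)\rho(gh)$, where $(\alpha f)(v)=\alpha f(v)$; it is normalized so that $\rho(1)=\mathrm{id}_V$. A $G$-lattice is a lattice $L$ with a map $G\times L\to L$ such that for all $g,h\in G$, $m,n\in L$: $g(hm)=(gh)m$; $em=m$; $m\le n$ iff $gm\le gn$; $g(m\wedge n)=gm\wedge gn$; $g(m\vee n)=gm\vee gn$. A $G$-lattice over $K$ is a $G$-lattice whose underlying lattice is the lattice $L(V)$ of all submodules of a $K$-module $V$ with $\operatorname{rank}(V)\ge 3$ ($V$ is part of the data). A representation $\rho:G\to SGL(V)$ determines the $G$-lattice $L=L(V)$ if $gW=\rho(g)W$ for all $g\in G$, $W\in L(V)$. Standing assumption: all lattice morphisms $f:L(V)\to L(V)$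 considered are coordinatizable, i.e. there is a semilinear transformation $f'$ of $V$ with $f(W)=f'(W)$ for all $W\in L(V)$. A factor system for $(K,G)$ is a pair of functions $\chi:G\to \operatorname{Aut}K$ (ring automorphisms) and $[\cdot,\cdot]:G\times G\to K^*$ such that for all $g,h,k\in G$ and $a\in K$: $\chi(g)(\chi(h)(a))=[g,h]\,\chi(gh)(a)\,[g,h]^{-1}$; $[g,h][gh,k]=\chi(g)([h,k])\,[g,hk]$; $[1,1]=1$. The associated extension of $K$ by $G$ is the group $H(\chi,[\cdot,\cdot])=\{a\overline g\mid a\in K^*, g\in G\}$ with product $(a\overline g)(b\overline h)=a\,\chi(g)(b)\,[g,h]\,\overline{gh}$. Factor systems $(\chi,[\cdot,\cdot])$ and $(\chi',[\cdot,\cdot]')$ are equivalent if there is $\mu:G\to K^*$ with $\chi'(g)(a)=\mu(g)^{-1}\chi(g)(a)\mu(g)$, $[g,h]\mu(gh)=\mu(g)\chi'(g)(\mu(h))[g,h]'$ and $\mu(1)=1$, for all $g,h\in G$, $a\in K$. A representation $\rho$ is associated with $(\chi,[\cdot,\cdot])$ if $\chi(g)=\theta_{\rho(g)}$ and $\rho(g)\rho(h)=[g,h]\rho(gh)$ for all $g,h\in G$. The extension $H(\chi,[\cdot,\cdot])$ is determined by the $G$-lattice $L$ if some representation determining $L$ is associated with $(\chi,[\cdot,\cdot])$. *)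

theory Defs
  imports "HOL-Algebra.Algebra"
begin

section \<open>Division rings and left modules\<close>

locale skew_field = ring K for K (structure) +
  assumes skew_field_Units: "Units K = carrier K - {\<zero>}"

text \<open>
  The locale \<^locale>\<open>module\<close> demands a commutative ring of scalars. The axioms below are the same
  ones over an arbitrary ring. The predicate \<^const>\<open>submodule\<close> makes sense in this generality.
\<close>

locale left_module = R?: ring K + M?: abelian_group V
  for K :: "('k, 'm) ring_scheme" (structure)
    and V :: "('k, 'v, 'n) module_scheme" (structure) +
  assumes lm_smult_closed:
      "\<lbrakk>a \<in> carrier K; x \<in> carrier V\<rbrakk> \<Longrightarrow> a \<odot>\<^bsub>V\<^esub> x \<in> carrier V"
    and lm_smult_l_distr:
      "\<lbrakk>a \<in> carrier K; b \<in> carrier K; x \<in> carrier V\<rbrakk> \<Longrightarrow>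
       (a \<oplus>\<^bsub>K\<^esub> b) \<odot>\<^bsub>V\<^esub> x = a \<odot>\<^bsub>V\<^esub> x \<oplus>\<^bsub>V\<^esub> b \<odot>\<^bsub>V\<^esub> x"
    and lm_smult_r_distr:
      "\<lbrakk>a \<in> carrier K; x \<in> carrier V; y \<in> carrier V\<rbrakk> \<Longrightarrow>
       a \<odot>\<^bsub>V\<^esub> (x \<oplus>\<^bsub>V\<^esub> y) = a \<odot>\<^bsub>V\<^esub> x \<oplus>\<^bsub>V\<^esub> a \<odot>\<^bsub>V\<^esub> y"
    and lm_smult_assoc:
      "\<lbrakk>a \<in> carrier K; b \<in> carrier K; x \<in> carrier V\<rbrakk> \<Longrightarrow>
       (a \<otimes>\<^bsub>K\<^esub> b) \<odot>\<^bsub>V\<^esub> x = a \<odot>\<^bsub>V\<^esub> (b \<odot>\<^bsub>V\<^esub> x)"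
    and lm_smult_one:
      "x \<in> carrier V \<Longrightarrow> \<one>\<^bsub>K\<^esub> \<odot>\<^bsub>V\<^esub> x = x"

definition is_basis :: "('k, 'm) ring_scheme \<Rightarrow> ('k, 'v, 'n) module_scheme \<Rightarrow> 'v set \<Rightarrow> bool" where
  "is_basis K V B \<longleftrightarrow>
     B \<subseteq> carrier V \<and>
     (\<forall>v \<in> carrier V. \<exists>S a. finite S \<and> S \<subseteq> B \<and> a \<in> S \<rightarrow> carrier K \<and>
        v = (\<Oplus>\<^bsub>V\<^esub> b \<in> S. a b \<odot>\<^bsub>V\<^esub> b)) \<and>
     (\<forall>S a. finite S \<and> S \<subseteq> B \<and> a \<in> S \<rightarrow> carrier K \<and>
        (\<Oplus>\<^bsub>V\<^esub> b \<in> S. a b \<odot>\<^bsub>V\<^esub> b) = \<zero>\<^bsub>V\<^esub> \<longrightarrow> (\<forall>b \<in> S. a b = \<zero>\<^bsub>K\<^esub>))"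

text \<open>
  The rank is the cardinality of a basis. Over a division ring every module has a basis and all
  bases have the same cardinality, so it does not matter which one is taken. The rank may be
  infinite, a case that \<^const>\<open>card\<close> would count as 0.
\<close>

definition rank_at_least ::
  "('k, 'm) ring_scheme \<Rightarrow> ('k, 'v, 'n) module_scheme \<Rightarrow> nat \<Rightarrow> bool" where
  "rank_at_least K V n \<longleftrightarrow> (\<exists>B. is_basis K V B \<and> (infinite B \<or> n \<le> card B))"

definition submodule_lattice ::
  "('k, 'm) ring_scheme \<Rightarrow> ('k, 'v, 'n) module_scheme \<Rightarrow> 'v set gorder" where
  "submodule_lattice K V =
     \<lparr>carrier = {W. submodule W K V}, eq = (=), le = (\<subseteq>)\<rparr>"


section \<open>Semilinear transformations and representations\<close>

text \<open>
  Here and below, maps between carriers are arbitrary functions of which only the values on the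
  carriers matter. All conditions on them are relative to the carriers.
\<close>

definition semilinear ::
  "('k, 'm) ring_scheme \<Rightarrow> ('k, 'v, 'n) module_scheme \<Rightarrow> ('k \<Rightarrow> 'k) \<Rightarrow> ('v \<Rightarrow> 'v) \<Rightarrow> bool" where
  "semilinear K V \<theta> f \<longleftrightarrow>
     \<theta> \<in> ring_iso K K \<and>
     f \<in> carrier V \<rightarrow> carrier V \<and>
     (\<forall>x \<in> carrier V. \<forall>y \<in> carrier V. f (x \<oplus>\<^bsub>V\<^esub> y) = f x \<oplus>\<^bsub>V\<^esub> f y) \<and>
     (\<forall>a \<in> carrier K. \<forall>x \<in> carrier V. f (a \<odot>\<^bsub>V\<^esub> x) = \<theta> a \<odot>\<^bsub>V\<^esub> f x)"

definition SGL :: "('k, 'm) ring_scheme \<Rightarrow> ('k, 'v, 'n) module_scheme \<Rightarrow> ('v \<Rightarrow> 'v) set" where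
  "SGL K V = {f. (\<exists>\<theta>. semilinear K V \<theta> f) \<and> bij_betw f (carrier V) (carrier V)}"

definition semilinear_rep ::
  "('k, 'm) ring_scheme \<Rightarrow> ('g, 'h) monoid_scheme \<Rightarrow> ('k, 'v, 'n) module_scheme
     \<Rightarrow> ('g \<Rightarrow> 'v \<Rightarrow> 'v) \<Rightarrow> bool" where
  "semilinear_rep K G V \<rho> \<longleftrightarrow>
     \<rho> \<in> carrier G \<rightarrow> SGL K V \<and>
     (\<forall>g \<in> carrier G. \<forall>h \<in> carrier G. \<exists>\<alpha> \<in> carrier K - {\<zero>\<^bsub>K\<^esub>}. \<forall>v \<in> carrier V.
        \<rho> g (\<rho> h v) = \<alpha> \<odot>\<^bsub>V\<^esub> \<rho> (g \<otimes>\<^bsub>G\<^esub> h) v) \<and>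
     (\<forall>v \<in> carrier V. \<rho> \<one>\<^bsub>G\<^esub> v = v)"


section \<open>Lattices with a group action\<close>

definition G_lattice ::
  "('g, 'h) monoid_scheme \<Rightarrow> ('l, 'm) gorder_scheme \<Rightarrow> ('g \<Rightarrow> 'l \<Rightarrow> 'l) \<Rightarrow> bool" where
  "G_lattice G L act \<longleftrightarrow>
     lattice L \<and>
     (\<forall>g \<in> carrier G. \<forall>m \<in> carrier L. act g m \<in> carrier L) \<and>
     (\<forall>g \<in> carrier G. \<forall>h \<in> carrier G. \<forall>m \<in> carrier L. act g (act h m) = act (g \<otimes>\<^bsub>G\<^esub> h) m) \<and>
     (\<forall>m \<in> carrier L. act \<one>\<^bsub>G\<^esub> m = m) \<and>
     (\<forall>g \<in> carrier G. \<forall>m \<in> carrier L. \<forall>n \<in> carrier L.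
        (m \<sqsubseteq>\<^bsub>L\<^esub> n \<longleftrightarrow> act g m \<sqsubseteq>\<^bsub>L\<^esub> act g n) \<and>
        act g (m \<sqinter>\<^bsub>L\<^esub> n) = act g m \<sqinter>\<^bsub>L\<^esub> act g n \<and>
        act g (m \<squnion>\<^bsub>L\<^esub> n) = act g m \<squnion>\<^bsub>L\<^esub> act g n)"

definition G_lattice_over ::
  "('k, 'm) ring_scheme \<Rightarrow> ('g, 'h) monoid_scheme \<Rightarrow> ('k, 'v, 'n) module_scheme
     \<Rightarrow> ('g \<Rightarrow> 'v set \<Rightarrow> 'v set) \<Rightarrow> bool" where
  "G_lattice_over K G V act \<longleftrightarrow>
     left_module K V \<and> rank_at_least K V 3 \<and> G_lattice G (submodule_lattice K V) act"

definition coordinatizable ::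
  "('k, 'm) ring_scheme \<Rightarrow> ('k, 'v, 'n) module_scheme \<Rightarrow> ('v set \<Rightarrow> 'v set) \<Rightarrow> bool" where
  "coordinatizable K V f \<longleftrightarrow>
     (\<exists>f' \<theta>. semilinear K V \<theta> f' \<and> (\<forall>W \<in> carrier (submodule_lattice K V). f W = f' ` W))"

definition rep_determines ::
  "('k, 'm) ring_scheme \<Rightarrow> ('g, 'h) monoid_scheme \<Rightarrow> ('k, 'v, 'n) module_scheme
     \<Rightarrow> ('g \<Rightarrow> 'v \<Rightarrow> 'v) \<Rightarrow> ('g \<Rightarrow> 'v set \<Rightarrow> 'v set) \<Rightarrow> bool" where
  "rep_determines K G V \<rho> act \<longleftrightarrow>
     (\<forall>g \<in> carrier G. \<forall>W \<in> carrier (submodule_lattice K V). act g W = \<rho> g ` W)"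


section \<open>Factor systems and extensions\<close>

definition factor_system ::
  "('k, 'm) ring_scheme \<Rightarrow> ('g, 'h) monoid_scheme \<Rightarrow> ('g \<Rightarrow> 'k \<Rightarrow> 'k) \<Rightarrow> ('g \<Rightarrow> 'g \<Rightarrow> 'k) \<Rightarrow> bool"
  where
  "factor_system K G \<chi> c \<longleftrightarrow>
     \<chi> \<in> carrier G \<rightarrow> ring_iso K K \<and>
     c \<in> carrier G \<rightarrow> carrier G \<rightarrow> carrier K - {\<zero>\<^bsub>K\<^esub>} \<and>
     (\<forall>g \<in> carrier G. \<forall>h \<in> carrier G. \<forall>a \<in> carrier K.
        \<chi> g (\<chi> h a) = c g h \<otimes>\<^bsub>K\<^esub> \<chi> (g \<otimes>\<^bsub>G\<^esub> h) a \<otimes>\<^bsub>K\<^esub> inv\<^bsub>K\<^esub> (c g h)) \<and>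
     (\<forall>g \<in> carrier G. \<forall>h \<in> carrier G. \<forall>k \<in> carrier G.
        c g h \<otimes>\<^bsub>K\<^esub> c (g \<otimes>\<^bsub>G\<^esub> h) k = \<chi> g (c h k) \<otimes>\<^bsub>K\<^esub> c g (h \<otimes>\<^bsub>G\<^esub> k)) \<and>
     c \<one>\<^bsub>G\<^esub> \<one>\<^bsub>G\<^esub> = \<one>\<^bsub>K\<^esub>"

text \<open>The pair \<open>(a, g)\<close> stands for the formal product of the scalar \<open>a\<close> and the symbol of \<open>g\<close>.\<close>

definition extension ::
  "('k, 'm) ring_scheme \<Rightarrow> ('g, 'h) monoid_scheme \<Rightarrow> ('g \<Rightarrow> 'k \<Rightarrow> 'k) \<Rightarrow> ('g \<Rightarrow> 'g \<Rightarrow> 'k)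
     \<Rightarrow> ('k \<times> 'g) monoid" where
  "extension K G \<chi> c =
     \<lparr>carrier = (carrier K - {\<zero>\<^bsub>K\<^esub>}) \<times> carrier G,
      monoid.mult = (\<lambda>(a, g) (b, h). (a \<otimes>\<^bsub>K\<^esub> \<chi> g b \<otimes>\<^bsub>K\<^esub> c g h, g \<otimes>\<^bsub>G\<^esub> h)),
      one = (\<one>\<^bsub>K\<^esub>, \<one>\<^bsub>G\<^esub>)\<rparr>"

definition factor_systems_equivalent ::
  "('k, 'm) ring_scheme \<Rightarrow> ('g, 'h) monoid_scheme
     \<Rightarrow> ('g \<Rightarrow> 'k \<Rightarrow> 'k) \<Rightarrow> ('g \<Rightarrow> 'g \<Rightarrow> 'k)
     \<Rightarrow> ('g \<Rightarrow> 'k \<Rightarrow> 'k) \<Rightarrow> ('g \<Rightarrow> 'g \<Rightarrow> 'k) \<Rightarrow> bool" where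
  "factor_systems_equivalent K G \<chi> c \<chi>' c' \<longleftrightarrow>
     (\<exists>\<mu> \<in> carrier G \<rightarrow> carrier K - {\<zero>\<^bsub>K\<^esub>}.
        (\<forall>g \<in> carrier G. \<forall>a \<in> carrier K.
           \<chi>' g a = inv\<^bsub>K\<^esub> (\<mu> g) \<otimes>\<^bsub>K\<^esub> \<chi> g a \<otimes>\<^bsub>K\<^esub> \<mu> g) \<and>
        (\<forall>g \<in> carrier G. \<forall>h \<in> carrier G.
           c g h \<otimes>\<^bsub>K\<^esub> \<mu> (g \<otimes>\<^bsub>G\<^esub> h) = \<mu> g \<otimes>\<^bsub>K\<^esub> \<chi>' g (\<mu> h) \<otimes>\<^bsub>K\<^esub> c' g h) \<and>
        \<mu> \<one>\<^bsub>G\<^esub> = \<one>\<^bsub>K\<^esub>)"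

text \<open>
  On a module of positive rank over a division ring the automorphism belonging to a semilinear map
  is unique, so the first conjunct says that \<open>\<chi> g\<close> is the automorphism of \<open>\<rho> g\<close>.
\<close>

definition rep_associated ::
  "('k, 'm) ring_scheme \<Rightarrow> ('g, 'h) monoid_scheme \<Rightarrow> ('k, 'v, 'n) module_scheme
     \<Rightarrow> ('g \<Rightarrow> 'v \<Rightarrow> 'v) \<Rightarrow> ('g \<Rightarrow> 'k \<Rightarrow> 'k) \<Rightarrow> ('g \<Rightarrow> 'g \<Rightarrow> 'k) \<Rightarrow> bool" where
  "rep_associated K G V \<rho> \<chi> c \<longleftrightarrow>
     (\<forall>g \<in> carrier G. semilinear K V (\<chi> g) (\<rho> g)) \<and>
     (\<forall>g \<in> carrier G. \<forall>h \<in> carrier G. \<forall>v \<in> carrier V.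
        \<rho> g (\<rho> h v) = c g h \<odot>\<^bsub>V\<^esub> \<rho> (g \<otimes>\<^bsub>G\<^esub> h) v)"

text \<open>
  The product of the extension fixes the values of \<open>\<chi>\<close> and \<open>c\<close> on the carriers. Hence nothing
  depends on the factor system chosen to present \<open>H\<close>; see \<open>extension_determined_iff\<close> below.
\<close>

definition extension_determined ::
  "('k, 'm) ring_scheme \<Rightarrow> ('g, 'h) monoid_scheme \<Rightarrow> ('k, 'v, 'n) module_scheme
     \<Rightarrow> ('g \<Rightarrow> 'v set \<Rightarrow> 'v set) \<Rightarrow> ('k \<times> 'g) monoid \<Rightarrow> bool" where
  "extension_determined K G V act H \<longleftrightarrow>
     (\<exists>\<chi> c. factor_system K G \<chi> c \<and> H = extension K G \<chi> c \<and>
        (\<exists>\<rho>. semilinear_rep K G V \<rho> \<and> rep_determines K G V \<rho> act \<and> rep_associated K G V \<rho> \<chi> c))"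


subsection \<open>Basic facts\<close>

lemma ring_isoD:
  assumes "t \<in> ring_iso K K" "a \<in> carrier K"
  shows "t a \<in> carrier K" "b \<in> carrier K \<Longrightarrow> t (a \<otimes>\<^bsub>K\<^esub> b) = t a \<otimes>\<^bsub>K\<^esub> t b" "t \<one>\<^bsub>K\<^esub> = \<one>\<^bsub>K\<^esub>"
  using assms ring_iso_memE[of t K K] by auto

lemma (in skew_field) auto_zero:
  assumes "t \<in> ring_iso K K"
  shows "t \<zero> = \<zero>"
  using assms ring_hom_zero[of t K K] ring_axioms by (auto simp: ring_iso_def)

lemma (in skew_field) auto_nonzero:
  assumes "t \<in> ring_iso K K" "a \<in> carrier K - {\<zero>}"
  shows "t a \<in> carrier K - {\<zero>}"
proof -
  have "inj_on t (carrier K)" using assms by (auto simp: ring_iso_def bij_betw_def)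
  then have "t a \<noteq> t \<zero>" using assms(2) by (auto dest: inj_onD)
  then show ?thesis using auto_zero[OF assms(1)] ring_isoD(1)[OF assms(1)] assms(2) by auto
qed

lemma (in skew_field) mult_nonzero:
  assumes "a \<in> carrier K - {\<zero>}" "b \<in> carrier K - {\<zero>}"
  shows "a \<otimes> b \<in> carrier K - {\<zero>}"
  using assms skew_field_Units by (metis Units_m_closed)

text \<open>The neutral element of the extension comes out as claimed because of \<open>[1, 1] = 1\<close>.\<close>

lemma extension_is_group:
  assumes K: "skew_field K" and G: "group G" and fs: "factor_system K G \<chi> c"
  shows "group (extension K G \<chi> c)"
proof -
  interpret K: skew_field K by fact
  interpret G: group G by fact
  let ?U = "carrier K - {\<zero>\<^bsub>K\<^esub>}"
  have U: "Units K = ?U" by (rule K.skew_field_Units)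
  have chi: "\<chi> g \<in> ring_iso K K" if "g \<in> carrier G" for g
    using fs that by (auto simp: factor_system_def)
  have c: "c g h \<in> ?U" if "g \<in> carrier G" "h \<in> carrier G" for g h
    using fs that unfolding factor_system_def by (meson Pi_mem)
  have conj: "\<chi> g (\<chi> h a) \<otimes>\<^bsub>K\<^esub> c g h = c g h \<otimes>\<^bsub>K\<^esub> \<chi> (g \<otimes>\<^bsub>G\<^esub> h) a"
    if "g \<in> carrier G" "h \<in> carrier G" "a \<in> carrier K" for g h a
  proof -
    have "\<chi> g (\<chi> h a) = c g h \<otimes>\<^bsub>K\<^esub> \<chi> (g \<otimes>\<^bsub>G\<^esub> h) a \<otimes>\<^bsub>K\<^esub> inv\<^bsub>K\<^esub> (c g h)"
      using fs that by (auto simp: factor_system_def)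
    moreover have "c g h \<in> Units K" using c that U by auto
    moreover have "\<chi> (g \<otimes>\<^bsub>G\<^esub> h) a \<in> carrier K" using ring_isoD(1)[OF chi] that by auto
    ultimately show ?thesis by (simp add: K.m_assoc K.Units_closed K.Units_l_inv)
  qed
  have coc: "c g h \<otimes>\<^bsub>K\<^esub> c (g \<otimes>\<^bsub>G\<^esub> h) k = \<chi> g (c h k) \<otimes>\<^bsub>K\<^esub> c g (h \<otimes>\<^bsub>G\<^esub> k)"
    if "g \<in> carrier G" "h \<in> carrier G" "k \<in> carrier G" for g h k
    using fs that by (auto simp: factor_system_def)
  have c11: "c \<one>\<^bsub>G\<^esub> \<one>\<^bsub>G\<^esub> = \<one>\<^bsub>K\<^esub>" using fs by (auto simp: factor_system_def)
  have inj: "inj_on (\<chi> g) (carrier K)" if "g \<in> carrier G" for g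
    using chi[OF that] by (auto simp: ring_iso_def bij_betw_def)
  have chi1: "\<chi> \<one>\<^bsub>G\<^esub> a = a" if "a \<in> carrier K" for a
  proof -
    have "\<chi> \<one>\<^bsub>G\<^esub> (\<chi> \<one>\<^bsub>G\<^esub> a) = \<chi> \<one>\<^bsub>G\<^esub> a"
      using conj[of "\<one>\<^bsub>G\<^esub>" "\<one>\<^bsub>G\<^esub>" a] that c11 ring_isoD(1)[OF chi] by auto
    then show ?thesis using inj[of "\<one>\<^bsub>G\<^esub>"] that ring_isoD(1)[OF chi, of "\<one>\<^bsub>G\<^esub>"]
      by (auto dest: inj_onD)
  qed
  have c1: "c \<one>\<^bsub>G\<^esub> k = \<one>\<^bsub>K\<^esub>" if k: "k \<in> carrier G" for k
  proof -
    have "\<one>\<^bsub>K\<^esub> \<otimes>\<^bsub>K\<^esub> c \<one>\<^bsub>G\<^esub> k = c \<one>\<^bsub>G\<^esub> k \<otimes>\<^bsub>K\<^esub> c \<one>\<^bsub>G\<^esub> k"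
      using coc[of "\<one>\<^bsub>G\<^esub>" "\<one>\<^bsub>G\<^esub>" k] k c11 chi1 c[of "\<one>\<^bsub>G\<^esub>" k] by auto
    moreover have "c \<one>\<^bsub>G\<^esub> k \<in> Units K" using c[of "\<one>\<^bsub>G\<^esub>" k] k U by auto
    ultimately show ?thesis
      by (metis K.Units_closed K.Units_l_cancel K.l_one K.one_closed K.r_one)
  qed
  note clo = ring_isoD(1)[OF chi] c
  show ?thesis
  proof (rule groupI)
    fix x y assume "x \<in> carrier (extension K G \<chi> c)" "y \<in> carrier (extension K G \<chi> c)"
    then show "x \<otimes>\<^bsub>extension K G \<chi> c\<^esub> y \<in> carrier (extension K G \<chi> c)"
      using K.mult_nonzero c K.auto_nonzero[OF chi]
      by (cases x; cases y) (simp add: extension_def)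
  next
    show "\<one>\<^bsub>extension K G \<chi> c\<^esub> \<in> carrier (extension K G \<chi> c)"
      using U K.Units_one_closed by (auto simp: extension_def)
  next
    fix x y z assume *: "x \<in> carrier (extension K G \<chi> c)" "y \<in> carrier (extension K G \<chi> c)"
      "z \<in> carrier (extension K G \<chi> c)"
    obtain a g b h d k where xyz: "x = (a, g)" "y = (b, h)" "z = (d, k)" by (metis surj_pair)
    have s: "a \<in> carrier K" "b \<in> carrier K" "d \<in> carrier K" "g \<in> carrier G" "h \<in> carrier G"
      "k \<in> carrier G" using * by (auto simp: extension_def xyz)
    have cc: "c u v \<in> carrier K" if "u \<in> carrier G" "v \<in> carrier G" for u v using c that by auto
    have xx: "\<chi> u t \<in> carrier K" if "u \<in> carrier G" "t \<in> carrier K" for u t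
      using ring_isoD(1)[OF chi] that by auto
    have mul: "\<chi> g (t \<otimes>\<^bsub>K\<^esub> u) = \<chi> g t \<otimes>\<^bsub>K\<^esub> \<chi> g u" if "t \<in> carrier K" "u \<in> carrier K" for t u
      using ring_isoD(2)[OF chi] that s by auto
    have "a \<otimes>\<^bsub>K\<^esub> \<chi> g b \<otimes>\<^bsub>K\<^esub> c g h \<otimes>\<^bsub>K\<^esub> \<chi> (g \<otimes>\<^bsub>G\<^esub> h) d \<otimes>\<^bsub>K\<^esub> c (g \<otimes>\<^bsub>G\<^esub> h) k
      = a \<otimes>\<^bsub>K\<^esub> \<chi> g b \<otimes>\<^bsub>K\<^esub> (c g h \<otimes>\<^bsub>K\<^esub> \<chi> (g \<otimes>\<^bsub>G\<^esub> h) d) \<otimes>\<^bsub>K\<^esub> c (g \<otimes>\<^bsub>G\<^esub> h) k"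
      using s by (simp add: K.m_assoc cc xx)
    also have "\<dots> = a \<otimes>\<^bsub>K\<^esub> \<chi> g b \<otimes>\<^bsub>K\<^esub> \<chi> g (\<chi> h d) \<otimes>\<^bsub>K\<^esub> (c g h \<otimes>\<^bsub>K\<^esub> c (g \<otimes>\<^bsub>G\<^esub> h) k)"
      using s by (simp add: conj[symmetric] K.m_assoc cc xx)
    also have "\<dots> = a \<otimes>\<^bsub>K\<^esub> \<chi> g (b \<otimes>\<^bsub>K\<^esub> \<chi> h d \<otimes>\<^bsub>K\<^esub> c h k) \<otimes>\<^bsub>K\<^esub> c g (h \<otimes>\<^bsub>G\<^esub> k)"
      using s by (simp add: coc mul K.m_assoc cc xx)
    finally show "x \<otimes>\<^bsub>extension K G \<chi> c\<^esub> y \<otimes>\<^bsub>extension K G \<chi> c\<^esub> z =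
        x \<otimes>\<^bsub>extension K G \<chi> c\<^esub> (y \<otimes>\<^bsub>extension K G \<chi> c\<^esub> z)"
      using s by (simp add: xyz extension_def G.m_assoc)
  next
    fix x assume "x \<in> carrier (extension K G \<chi> c)"
    then show "\<one>\<^bsub>extension K G \<chi> c\<^esub> \<otimes>\<^bsub>extension K G \<chi> c\<^esub> x = x"
      by (auto simp: extension_def chi1 c1)
  next
    fix x assume *: "x \<in> carrier (extension K G \<chi> c)"
    obtain a g where x: "x = (a, g)" by (metis surj_pair)
    have ag: "a \<in> ?U" "g \<in> carrier G" using * by (auto simp: extension_def x)
    let ?g = "inv\<^bsub>G\<^esub> g"
    let ?u = "\<chi> ?g a \<otimes>\<^bsub>K\<^esub> c ?g g"
    have "?u \<in> Units K" using K.mult_nonzero K.auto_nonzero[OF chi] c ag U by auto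
    then have u: "inv\<^bsub>K\<^esub> ?u \<in> ?U" "inv\<^bsub>K\<^esub> ?u \<otimes>\<^bsub>K\<^esub> ?u = \<one>\<^bsub>K\<^esub>"
      using U K.Units_inv_Units[of ?u] by auto
    have "\<chi> ?g a \<in> carrier K" "c ?g g \<in> carrier K" using clo ag by auto
    then have "inv\<^bsub>K\<^esub> ?u \<otimes>\<^bsub>K\<^esub> \<chi> ?g a \<otimes>\<^bsub>K\<^esub> c ?g g = \<one>\<^bsub>K\<^esub>"
      using u K.m_assoc by auto
    then show "\<exists>y \<in> carrier (extension K G \<chi> c).
        y \<otimes>\<^bsub>extension K G \<chi> c\<^esub> x = \<one>\<^bsub>extension K G \<chi> c\<^esub>"
      using u(1) ag by (intro bexI[of _ "(inv\<^bsub>K\<^esub> ?u, ?g)"]) (auto simp: extension_def x)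
  qed
qed

lemma extension_eqD:
  assumes K: "skew_field K"
    and fs: "factor_system K G \<chi> c" and fs': "factor_system K G \<chi>' c'"
    and eq: "extension K G \<chi> c = extension K G \<chi>' c'"
    and g: "g \<in> carrier G"
  shows "h \<in> carrier G \<Longrightarrow> c g h = c' g h"
    and "a \<in> carrier K \<Longrightarrow> \<chi> g a = \<chi>' g a"
proof -
  interpret K: skew_field K by fact
  have chi: "\<chi> g \<in> ring_iso K K" "\<chi>' g \<in> ring_iso K K"
    using fs fs' g by (auto simp: factor_system_def)
  have c: "c g h \<in> Units K" "c' g h \<in> Units K" if "h \<in> carrier G" for h
    using fs fs' g that unfolding factor_system_def K.skew_field_Units by (meson Pi_mem)+
  have "(\<lambda>(a, g) (b, h). (a \<otimes>\<^bsub>K\<^esub> \<chi> g b \<otimes>\<^bsub>K\<^esub> c g h, g \<otimes>\<^bsub>G\<^esub> h)) =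
        (\<lambda>(a, g) (b, h). (a \<otimes>\<^bsub>K\<^esub> \<chi>' g b \<otimes>\<^bsub>K\<^esub> c' g h, g \<otimes>\<^bsub>G\<^esub> h))"
    using eq by (simp add: extension_def)
  from fun_cong[OF fun_cong[OF this, of "(\<one>\<^bsub>K\<^esub>, g)"]]
  have m: "\<one>\<^bsub>K\<^esub> \<otimes>\<^bsub>K\<^esub> \<chi> g b \<otimes>\<^bsub>K\<^esub> c g h = \<one>\<^bsub>K\<^esub> \<otimes>\<^bsub>K\<^esub> \<chi>' g b \<otimes>\<^bsub>K\<^esub> c' g h" for b h
    by (auto dest: spec[of _ "(b, h)"] simp: fun_eq_iff)
  show cc: "c g h = c' g h" if "h \<in> carrier G" for h
    using m[of "\<one>\<^bsub>K\<^esub>" h] c[OF that] ring_isoD(3)[OF chi(1) K.one_closed]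
      ring_isoD(3)[OF chi(2) K.one_closed] by (auto simp: K.Units_closed)
  show "\<chi> g a = \<chi>' g a" if "a \<in> carrier K"
    using m[of a g] cc[OF g] c[OF g] ring_isoD(1)[OF chi(1) that] ring_isoD(1)[OF chi(2) that]
    by (metis K.Units_closed K.Units_inv_closed K.Units_r_inv K.l_one K.m_assoc K.r_one)
qed

lemma extension_determined_iff:
  assumes K: "skew_field K" and G: "group G" and fs: "factor_system K G \<chi> c"
  shows "extension_determined K G V act (extension K G \<chi> c) \<longleftrightarrow>
    (\<exists>\<rho>. semilinear_rep K G V \<rho> \<and> rep_determines K G V \<rho> act \<and> rep_associated K G V \<rho> \<chi> c)"
    (is "?L \<longleftrightarrow> ?R")
proof
  assume ?L
  then obtain \<chi>' c' \<rho> where *: "factor_system K G \<chi>' c'"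
    "extension K G \<chi> c = extension K G \<chi>' c'" "semilinear_rep K G V \<rho>"
    "rep_determines K G V \<rho> act" "rep_associated K G V \<rho> \<chi>' c'"
    unfolding extension_determined_def by blast
  note e = extension_eqD[OF K fs *(1,2)]
  have "semilinear K V (\<chi> g) (\<rho> g)" if "g \<in> carrier G" for g
    using *(5) that fs e(2)[OF that] unfolding rep_associated_def semilinear_def factor_system_def
    by (auto simp: Pi_iff)
  then have "rep_associated K G V \<rho> \<chi> c"
    using *(5) e(1) unfolding rep_associated_def by auto
  then show ?R using * by blast
next
  assume ?R
  then show ?L using fs unfolding extension_determined_def by blast
qed

end

theory Submission
  imports Defs
begin

text \<open>
  The whole correspondence rests on one ambiguity: on a module of rank at least 2, a semilinear
  bijection \<open>f\<close> is determined by the map \<open>W \<mapsto> f W\<close> on submodules up to a nonzero scalar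
  (\<open>same_lattice_map_scalar\<close>), and nonzero scalars do fix every submodule. This is the uniqueness
  half of the fundamental theorem of projective geometry; the existence half is the assumption
  that the action is coordinatizable.

  From a lattice to an extension: choose for every \<open>g\<close> a semilinear map \<open>\<rho> g\<close> that induces the
  action of \<open>g\<close>. Since \<open>\<rho> g \<circ> \<rho> h\<close> and \<open>\<rho> (g h)\<close> induce the same lattice map, they differ by a
  scalar \<open>[g, h]\<close> (\<open>lattice_determines_rep\<close>). The two laws of a factor system say that
  \<open>\<rho> g \<circ> \<rho> h\<close> and \<open>[g, h] \<cdot> \<rho> (g h)\<close> have the same automorphism and that composition is
  associative (\<open>factor_system_of_rep\<close>). Another choice \<open>\<rho>'\<close> satisfies
  \<open>\<rho> g = \<mu> g \<cdot> \<rho>' g\<close>, and substituting this into the defining relations of the factor systems shows that \<open>\<mu>\<close> is an equivalence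
  (\<open>lattice_reps_equivalent\<close>).

  From an extension to a lattice: a factor system makes the free module with basis \<open>{u\<^sub>g | g \<in> G}\<close>
  into the crossed product of \<open>K\<close> and \<open>G\<close>, and left multiplication by \<open>u\<^sub>g\<close> is a semilinear map
  whose automorphism is \<open>\<chi> g\<close> and whose products obey the given cocycle
  (\<open>twisted_translation_rep\<close>). Three copies of the crossed product have rank at least 3 even when
  \<open>G\<close> is trivial. On submodules the scalars disappear, so this representation becomes an action of \<open>G\<close> on
  the lattice (\<open>lattice_of_rep\<close>).
\<close>

section \<open>Modules over a division ring\<close>

locale skew_module = R?: skew_field K + left_module K V for K (structure) and V (structure)
begin

abbreviation nonzero_scalars ("K\<^sup>*") where
  "K\<^sup>* \<equiv> carrier K - {\<zero>}"

lemma nonzero_inv: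
  assumes "a \<in> K\<^sup>*"
  shows "inv a \<in> K\<^sup>*" "inv a \<otimes> a = \<one>" "a \<otimes> inv a = \<one>"
  using assms skew_field_Units Units_inv_Units Units_l_inv Units_r_inv by blast+

lemma one_nonzero: "\<one> \<in> K\<^sup>*"
  using skew_field_Units Units_one_closed by auto

lemma smult_zero_left: "x \<in> carrier V \<Longrightarrow> \<zero> \<odot>\<^bsub>V\<^esub> x = \<zero>\<^bsub>V\<^esub>"
  using lm_smult_l_distr[of \<zero> \<zero> x] lm_smult_closed[of \<zero> x]
  by (metis M.add.r_cancel_one' R.l_zero R.zero_closed)

lemma smult_zero_right: "a \<in> carrier K \<Longrightarrow> a \<odot>\<^bsub>V\<^esub> \<zero>\<^bsub>V\<^esub> = \<zero>\<^bsub>V\<^esub>"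
  using lm_smult_r_distr[of a "\<zero>\<^bsub>V\<^esub>" "\<zero>\<^bsub>V\<^esub>"] lm_smult_closed[of a "\<zero>\<^bsub>V\<^esub>"]
  by (metis M.add.r_cancel_one' M.l_zero M.zero_closed)

lemma smult_minus_left:
  assumes "a \<in> carrier K" "x \<in> carrier V"
  shows "(\<ominus> a) \<odot>\<^bsub>V\<^esub> x = \<ominus>\<^bsub>V\<^esub> (a \<odot>\<^bsub>V\<^esub> x)"
proof -
  have "(\<ominus> a) \<odot>\<^bsub>V\<^esub> x \<oplus>\<^bsub>V\<^esub> a \<odot>\<^bsub>V\<^esub> x = \<zero>\<^bsub>V\<^esub>"
    using lm_smult_l_distr[of "\<ominus> a" a x] assms by (simp add: R.l_neg smult_zero_left)
  then show ?thesis
    using M.minus_equality[of "(\<ominus> a) \<odot>\<^bsub>V\<^esub> x" "a \<odot>\<^bsub>V\<^esub> x"] assms lm_smult_closed by simp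
qed

lemma smult_eq_zeroD:
  assumes "a \<odot>\<^bsub>V\<^esub> x = \<zero>\<^bsub>V\<^esub>" "a \<in> K\<^sup>*" "x \<in> carrier V"
  shows "x = \<zero>\<^bsub>V\<^esub>"
  using assms lm_smult_assoc[of "inv a" a x] nonzero_inv[of a] lm_smult_one smult_zero_right
  by auto

lemma smult_left_cancel:
  assumes "a \<odot>\<^bsub>V\<^esub> x = a \<odot>\<^bsub>V\<^esub> y" "a \<in> K\<^sup>*" "x \<in> carrier V" "y \<in> carrier V"
  shows "x = y"
  using assms lm_smult_assoc[of "inv a" a x] lm_smult_assoc[of "inv a" a y] nonzero_inv[of a]
    lm_smult_one by auto

lemma smult_diff:
  assumes "a \<in> carrier K" "b \<in> carrier K" "x \<in> carrier V"
  shows "(a \<ominus> b) \<odot>\<^bsub>V\<^esub> x = a \<odot>\<^bsub>V\<^esub> x \<ominus>\<^bsub>V\<^esub> b \<odot>\<^bsub>V\<^esub> x"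
  using assms by (simp add: a_minus_def lm_smult_l_distr smult_minus_left)

lemma smult_right_cancel:
  assumes eq: "a \<odot>\<^bsub>V\<^esub> x = b \<odot>\<^bsub>V\<^esub> x"
    and x: "x \<in> carrier V" "x \<noteq> \<zero>\<^bsub>V\<^esub>" and ab: "a \<in> carrier K" "b \<in> carrier K"
  shows "a = b"
proof -
  have "(a \<ominus> b) \<odot>\<^bsub>V\<^esub> x = \<zero>\<^bsub>V\<^esub>"
    using smult_diff[OF ab x(1)] eq x ab lm_smult_closed by (simp add: M.r_neg a_minus_def)
  then have "a \<ominus> b = \<zero>"
    using smult_eq_zeroD[of "a \<ominus> b" x] x ab by auto
  then show ?thesis using ab by simp
qed

text \<open>
  Closure under negation follows from \<open>- x = (- 1) x\<close>.
\<close>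

lemma submodule_iff:
  "submodule W K V \<longleftrightarrow>
     W \<subseteq> carrier V \<and> \<zero>\<^bsub>V\<^esub> \<in> W \<and> (\<forall>x \<in> W. \<forall>y \<in> W. x \<oplus>\<^bsub>V\<^esub> y \<in> W) \<and>
     (\<forall>a \<in> carrier K. \<forall>x \<in> W. a \<odot>\<^bsub>V\<^esub> x \<in> W)" (is "_ \<longleftrightarrow> ?R")
proof
  assume "submodule W K V"
  then show ?R
    unfolding submodule_def subgroup_def submodule_axioms_def by auto
next
  assume W: ?R
  have "\<ominus>\<^bsub>V\<^esub> x \<in> W" if "x \<in> W" for x
    using that W smult_minus_left[of \<one> x] lm_smult_one[of x]
    by (metis R.a_inv_closed R.one_closed subsetD)
  with W show "submodule W K V"
    unfolding submodule_def subgroup_def submodule_axioms_def by (auto simp: a_inv_def)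
qed

definition line :: "'c \<Rightarrow> 'c set" where
  "line v = (\<lambda>a. a \<odot>\<^bsub>V\<^esub> v) ` carrier K"

lemma line_submodule:
  assumes v: "v \<in> carrier V"
  shows "submodule (line v) K V"
proof -
  have "a \<odot>\<^bsub>V\<^esub> v \<oplus>\<^bsub>V\<^esub> b \<odot>\<^bsub>V\<^esub> v \<in> line v" if "a \<in> carrier K" "b \<in> carrier K" for a b
    using that v lm_smult_l_distr[of a b v] by (metis R.add.m_closed imageI line_def)
  moreover have "a \<odot>\<^bsub>V\<^esub> (b \<odot>\<^bsub>V\<^esub> v) \<in> line v" if "a \<in> carrier K" "b \<in> carrier K" for a b
    using that v lm_smult_assoc[of a b v] by (metis R.m_closed imageI line_def)
  moreover have "\<zero>\<^bsub>V\<^esub> \<in> line v"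
    using smult_zero_left[OF v] by (metis R.zero_closed imageI line_def)
  ultimately show ?thesis
    using v lm_smult_closed unfolding submodule_iff by (auto simp: line_def)
qed

lemma mem_line_self: "v \<in> carrier V \<Longrightarrow> v \<in> line v"
  using lm_smult_one by (metis R.one_closed imageI line_def)

lemma zero_submodule: "submodule {\<zero>\<^bsub>V\<^esub>} K V"
  unfolding submodule_iff using smult_zero_right by auto

lemma carrier_submodule: "submodule (carrier V) K V"
  unfolding submodule_iff using lm_smult_closed by auto

lemma smult_image_submodule:
  assumes W: "submodule W K V" and a: "a \<in> K\<^sup>*"
  shows "(\<lambda>x. a \<odot>\<^bsub>V\<^esub> x) ` W = W"
proof -
  have "x \<in> (\<lambda>x. a \<odot>\<^bsub>V\<^esub> x) ` W" if x: "x \<in> W" for x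
  proof
    have "x \<in> carrier V" using W x unfolding submodule_iff by auto
    then show "x = a \<odot>\<^bsub>V\<^esub> (inv a \<odot>\<^bsub>V\<^esub> x)"
      using a nonzero_inv[OF a] lm_smult_assoc[of a "inv a" x] lm_smult_one by auto
    show "inv a \<odot>\<^bsub>V\<^esub> x \<in> W"
      using W x nonzero_inv[OF a] unfolding submodule_iff by auto
  qed
  then show ?thesis using W a unfolding submodule_iff by auto
qed

text \<open>
  Two distinct basis vectors will do. This is how the rank enters the comparison of semilinear maps.
\<close>

lemma rank_ge_two_off_line:
  assumes "rank_at_least K V 2"
  obtains u v where "u \<in> carrier V" "v \<in> carrier V" "v \<noteq> \<zero>\<^bsub>V\<^esub>" "u \<notin> line v"
proof -
  obtain B where B: "is_basis K V B" "infinite B \<or> 2 \<le> card B"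
    using assms unfolding rank_at_least_def by auto
  then obtain T where T: "T \<subseteq> B" "card T = 2"
    by (metis obtain_subset_with_card_n infinite_arbitrarily_large)
  then obtain u v where uv: "u \<in> B" "v \<in> B" "u \<noteq> v"
    by (auto simp: card_2_iff)
  have car: "u \<in> carrier V" "v \<in> carrier V"
    using B(1) uv unfolding is_basis_def by auto
  have ind: "\<forall>b \<in> S. a b = \<zero>"
    if "finite S" "S \<subseteq> B" "a \<in> S \<rightarrow> carrier K" "(\<Oplus>\<^bsub>V\<^esub> b \<in> S. a b \<odot>\<^bsub>V\<^esub> b) = \<zero>\<^bsub>V\<^esub>" for S a
    using B(1) that unfolding is_basis_def by blast
  have "v \<noteq> \<zero>\<^bsub>V\<^esub>"
  proof
    assume "v = \<zero>\<^bsub>V\<^esub>"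
    then have "(\<Oplus>\<^bsub>V\<^esub> b \<in> {v}. \<one> \<odot>\<^bsub>V\<^esub> b) = \<zero>\<^bsub>V\<^esub>"
      using smult_zero_right[of \<one>] by simp
    then show False using ind[of "{v}" "\<lambda>_. \<one>"] uv one_nonzero by auto
  qed
  moreover have "u \<notin> line v"
  proof
    assume "u \<in> line v"
    then obtain a where a: "a \<in> carrier K" "u = a \<odot>\<^bsub>V\<^esub> v" by (auto simp: line_def)
    let ?a = "\<lambda>b. if b = u then \<one> else \<ominus> a"
    have "(\<Oplus>\<^bsub>V\<^esub> b \<in> {u, v}. ?a b \<odot>\<^bsub>V\<^esub> b) = u \<oplus>\<^bsub>V\<^esub> (\<ominus> a) \<odot>\<^bsub>V\<^esub> v"
      using uv car a(1) lm_smult_closed lm_smult_one by (subst M.finsum_insert) auto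
    also have "\<dots> = \<zero>\<^bsub>V\<^esub>"
      using a car smult_minus_left[of a v] M.r_neg[OF car(1)] by simp
    finally show False using ind[of "{u, v}" ?a] uv one_nonzero a by auto
  qed
  ultimately show thesis using that car by blast
qed

end

lemma rank_at_least_mono: "rank_at_least K V n \<Longrightarrow> m \<le> n \<Longrightarrow> rank_at_least K V m"
  unfolding rank_at_least_def using le_trans by blast


section \<open>Semilinear maps and the lattice of submodules\<close>

lemma semilinearD:
  assumes "semilinear K V \<theta> f"
  shows "\<theta> \<in> ring_iso K K"
    and "x \<in> carrier V \<Longrightarrow> f x \<in> carrier V"
    and "x \<in> carrier V \<Longrightarrow> y \<in> carrier V \<Longrightarrow> f (x \<oplus>\<^bsub>V\<^esub> y) = f x \<oplus>\<^bsub>V\<^esub> f y"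
    and "a \<in> carrier K \<Longrightarrow> x \<in> carrier V \<Longrightarrow> f (a \<odot>\<^bsub>V\<^esub> x) = \<theta> a \<odot>\<^bsub>V\<^esub> f x"
  using assms unfolding semilinear_def by auto

lemma semilinear_repI:
  assumes sl: "\<And>g. g \<in> carrier G \<Longrightarrow> semilinear K V (\<chi> g) (\<rho> g)"
    and bij: "\<And>g. g \<in> carrier G \<Longrightarrow> bij_betw (\<rho> g) (carrier V) (carrier V)"
    and c: "\<And>g h. g \<in> carrier G \<Longrightarrow> h \<in> carrier G \<Longrightarrow> c g h \<in> carrier K - {\<zero>\<^bsub>K\<^esub>}"
    and comp: "\<And>g h v. g \<in> carrier G \<Longrightarrow> h \<in> carrier G \<Longrightarrow> v \<in> carrier V \<Longrightarrow>
      \<rho> g (\<rho> h v) = c g h \<odot>\<^bsub>V\<^esub> \<rho> (g \<otimes>\<^bsub>G\<^esub> h) v"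
    and one: "\<And>v. v \<in> carrier V \<Longrightarrow> \<rho> \<one>\<^bsub>G\<^esub> v = v"
  shows "semilinear_rep K G V \<rho>"
  unfolding semilinear_rep_def
proof (intro conjI ballI funcsetI)
  fix g assume g: "g \<in> carrier G"
  show "\<rho> g \<in> SGL K V" unfolding SGL_def using sl[OF g] bij[OF g] by blast
  fix h assume h: "h \<in> carrier G"
  show "\<exists>\<alpha> \<in> carrier K - {\<zero>\<^bsub>K\<^esub>}. \<forall>v \<in> carrier V. \<rho> g (\<rho> h v) = \<alpha> \<odot>\<^bsub>V\<^esub> \<rho> (g \<otimes>\<^bsub>G\<^esub> h) v"
    by (rule bexI[of _ "c g h"]) (use g h in \<open>simp_all add: comp c[simplified]\<close>)
qed (rule one)

lemma ring_iso_surj: "t \<in> ring_iso K K \<Longrightarrow> t ` carrier K = carrier K"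
  by (simp add: ring_iso_def bij_betw_def)

lemma mem_submodule_lattice: "W \<in> carrier (submodule_lattice K V) \<longleftrightarrow> submodule W K V"
  and le_submodule_lattice: "le (submodule_lattice K V) = (\<subseteq>)"
  by (simp_all add: submodule_lattice_def)

context skew_module
begin

lemma semilinear_zero:
  assumes "semilinear K V \<theta> f"
  shows "f \<zero>\<^bsub>V\<^esub> = \<zero>\<^bsub>V\<^esub>"
  using semilinearD(2,3)[OF assms, of "\<zero>\<^bsub>V\<^esub>"] 
  by (metis M.add.r_cancel_one' M.l_zero M.zero_closed)

lemma semilinear_image_submodule:
  assumes f: "semilinear K V \<theta> f" and W: "submodule W K V"
  shows "submodule (f ` W) K V"
proof -
  have sub: "W \<subseteq> carrier V" using W unfolding submodule_iff by auto
  have "a \<odot>\<^bsub>V\<^esub> f x \<in> f ` W" if "a \<in> carrier K" "x \<in> W" for a x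
  proof -
    \<comment> \<open>Surjectivity of the automorphism turns every scalar multiple of an image into an image.\<close>
    obtain b where "b \<in> carrier K" "\<theta> b = a"
      using ring_iso_surj[OF semilinearD(1)[OF f]] \<open>a \<in> carrier K\<close> by (metis imageE)
    then show ?thesis
      using semilinearD(4)[OF f, of b x] that sub W unfolding submodule_iff by (metis imageI subsetD)
  qed
  moreover have "f x \<oplus>\<^bsub>V\<^esub> f y \<in> f ` W" if "x \<in> W" "y \<in> W" for x y
    using semilinearD(3)[OF f, of x y] that sub W unfolding submodule_iff by (metis imageI subsetD)
  moreover have "\<zero>\<^bsub>V\<^esub> \<in> f ` W"
    using semilinear_zero[OF f] W unfolding submodule_iff by (metis imageI)
  ultimately show ?thesis
    using sub semilinearD(2)[OF f] unfolding submodule_iff by auto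
qed

text \<open>
  Compare the two expressions for \<open>f (a v)\<close>. For \<open>\<mu> = 1\<close> and \<open>f = f'\<close> this is the uniqueness of
  the automorphism of a nonzero semilinear map.
\<close>

lemma semilinear_scalars_conj:
  assumes f: "semilinear K V \<theta> f" and f': "semilinear K V \<theta>' f'"
    and m: "\<mu> \<in> carrier K" and eq: "\<And>x. x \<in> carrier V \<Longrightarrow> f x = \<mu> \<odot>\<^bsub>V\<^esub> f' x"
    and v: "v \<in> carrier V" "f' v \<noteq> \<zero>\<^bsub>V\<^esub>" and a: "a \<in> carrier K"
  shows "\<theta> a \<otimes> \<mu> = \<mu> \<otimes> \<theta>' a"
proof -
  note clo = ring_isoD(1)[OF semilinearD(1)[OF f] a] ring_isoD(1)[OF semilinearD(1)[OF f'] a]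
    semilinearD(2)[OF f' v(1)]
  have "(\<theta> a \<otimes> \<mu>) \<odot>\<^bsub>V\<^esub> f' v = f (a \<odot>\<^bsub>V\<^esub> v)"
    using semilinearD(4)[OF f a v(1)] eq[OF v(1)] clo m by (simp add: lm_smult_assoc)
  also have "\<dots> = (\<mu> \<otimes> \<theta>' a) \<odot>\<^bsub>V\<^esub> f' v"
    using semilinearD(4)[OF f' a v(1)] eq[OF lm_smult_closed[OF a v(1)]] clo m
    by (simp add: lm_smult_assoc)
  finally show ?thesis
    using smult_right_cancel clo m v by simp
qed

text \<open>
  The uniqueness half of the fundamental theorem of projective geometry. Both maps send the line
  of \<open>v\<close> to the same line, so \<open>f v = \<alpha> v \<cdot> f' v\<close>. If \<open>v \<noteq> 0\<close> and \<open>w\<close> is not on the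
  line of \<open>v\<close>, then \<open>f' v\<close> and \<open>f' w\<close> are independent, so comparing \<open>f (v + w) = f v + f w\<close> with
  \<open>\<alpha> (v + w) \<cdot> (f' v + f' w)\<close> gives \<open>\<alpha> v = \<alpha> (v + w) = \<alpha> w\<close>.
  Two vectors on one line are compared through a third vector off that line.
\<close>

lemma same_lattice_map_scalar:
  assumes rank: "rank_at_least K V 2"
    and f: "semilinear K V \<theta> f" and f': "semilinear K V \<theta>' f'"
    and inj: "inj_on f (carrier V)" "inj_on f' (carrier V)"
    and same: "\<And>W. submodule W K V \<Longrightarrow> f ` W = f' ` W"
  obtains \<mu> where "\<mu> \<in> K\<^sup>*" "\<And>v. v \<in> carrier V \<Longrightarrow> f v = \<mu> \<odot>\<^bsub>V\<^esub> f' v"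
proof -
  note car = semilinearD(2)[OF f] semilinearD(2)[OF f']
  have nz: "f v \<noteq> \<zero>\<^bsub>V\<^esub>" "f' v \<noteq> \<zero>\<^bsub>V\<^esub>" if "v \<in> carrier V" "v \<noteq> \<zero>\<^bsub>V\<^esub>" for v
    using that inj semilinear_zero[OF f] semilinear_zero[OF f'] M.zero_closed
    by (metis inj_onD)+
  have "\<exists>a \<in> carrier K. f v = a \<odot>\<^bsub>V\<^esub> f' v" if v: "v \<in> carrier V" for v
  proof -
    have "f v \<in> f' ` line v"
      using same[OF line_submodule[OF v]] mem_line_self[OF v] by blast
    then obtain b where "b \<in> carrier K" "f v = f' (b \<odot>\<^bsub>V\<^esub> v)" by (auto simp: line_def)
    then show ?thesis
      using semilinearD(4)[OF f' _ v] ring_isoD(1)[OF semilinearD(1)[OF f']] by metis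
  qed
  then obtain \<alpha> where \<alpha>: "\<alpha> v \<in> carrier K" "f v = \<alpha> v \<odot>\<^bsub>V\<^esub> f' v" if "v \<in> carrier V" for v
    by metis
  have indep: "\<alpha> v = \<alpha> w"
    if v: "v \<in> carrier V" "v \<noteq> \<zero>\<^bsub>V\<^esub>" and w: "w \<in> carrier V" "w \<notin> line v" for v w
  proof -
    let ?s = "\<alpha> (v \<oplus>\<^bsub>V\<^esub> w)"
    have vw: "v \<oplus>\<^bsub>V\<^esub> w \<in> carrier V" using v w by simp
    note c = \<alpha>(1)[OF v(1)] \<alpha>(1)[OF w(1)] \<alpha>(1)[OF vw] car(2)[OF v(1)] car(2)[OF w(1)]
    note c' = c lm_smult_closed[OF c(1,4)] lm_smult_closed[OF c(2,5)]
      lm_smult_closed[OF c(3,4)] lm_smult_closed[OF c(3,5)]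
    have "?s \<odot>\<^bsub>V\<^esub> f' v \<oplus>\<^bsub>V\<^esub> ?s \<odot>\<^bsub>V\<^esub> f' w = f (v \<oplus>\<^bsub>V\<^esub> w)"
      using \<alpha>(2)[OF vw] semilinearD(3)[OF f' v(1) w(1)] c by (simp add: lm_smult_r_distr)
    also have "\<dots> = \<alpha> v \<odot>\<^bsub>V\<^esub> f' v \<oplus>\<^bsub>V\<^esub> \<alpha> w \<odot>\<^bsub>V\<^esub> f' w"
      using semilinearD(3)[OF f v(1) w(1)] \<alpha>(2)[OF v(1)] \<alpha>(2)[OF w(1)] by simp
    finally have sum: "?s \<odot>\<^bsub>V\<^esub> f' v \<oplus>\<^bsub>V\<^esub> ?s \<odot>\<^bsub>V\<^esub> f' w = \<alpha> v \<odot>\<^bsub>V\<^esub> f' v \<oplus>\<^bsub>V\<^esub> \<alpha> w \<odot>\<^bsub>V\<^esub> f' w" .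
    have "?s \<odot>\<^bsub>V\<^esub> f' w = (\<ominus>\<^bsub>V\<^esub> (?s \<odot>\<^bsub>V\<^esub> f' v)) \<oplus>\<^bsub>V\<^esub> (?s \<odot>\<^bsub>V\<^esub> f' v \<oplus>\<^bsub>V\<^esub> ?s \<odot>\<^bsub>V\<^esub> f' w)"
      using M.r_neg1 c' by simp
    also have "\<dots> = (\<alpha> v \<odot>\<^bsub>V\<^esub> f' v \<ominus>\<^bsub>V\<^esub> ?s \<odot>\<^bsub>V\<^esub> f' v) \<oplus>\<^bsub>V\<^esub> \<alpha> w \<odot>\<^bsub>V\<^esub> f' w"
      unfolding sum a_minus_def using c' by (simp add: M.a_ac)
    finally have "?s \<odot>\<^bsub>V\<^esub> f' w \<ominus>\<^bsub>V\<^esub> \<alpha> w \<odot>\<^bsub>V\<^esub> f' w = \<alpha> v \<odot>\<^bsub>V\<^esub> f' v \<ominus>\<^bsub>V\<^esub> ?s \<odot>\<^bsub>V\<^esub> f' v"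
      using c' by (simp add: a_minus_def M.a_assoc M.r_neg)
    then have diff: "(?s \<ominus> \<alpha> w) \<odot>\<^bsub>V\<^esub> f' w = (\<alpha> v \<ominus> ?s) \<odot>\<^bsub>V\<^esub> f' v"
      using c by (simp add: smult_diff)
    have sw: "?s = \<alpha> w"
    proof (rule ccontr)
      assume "?s \<noteq> \<alpha> w"
      then have d: "?s \<ominus> \<alpha> w \<in> K\<^sup>*" using c by auto
      \<comment> \<open>Otherwise \<open>f' w\<close> is a multiple of \<open>f' v\<close>, and injectivity puts \<open>w\<close> on the line of \<open>v\<close>.\<close>
      let ?t = "inv (?s \<ominus> \<alpha> w) \<otimes> (\<alpha> v \<ominus> ?s)"
      have "f' w = inv (?s \<ominus> \<alpha> w) \<odot>\<^bsub>V\<^esub> ((?s \<ominus> \<alpha> w) \<odot>\<^bsub>V\<^esub> f' w)"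
        using d nonzero_inv[OF d] c lm_smult_one lm_smult_assoc[of "inv (?s \<ominus> \<alpha> w)" "?s \<ominus> \<alpha> w" "f' w"]
        by auto
      also have "\<dots> = ?t \<odot>\<^bsub>V\<^esub> f' v"
        unfolding diff using nonzero_inv(1)[OF d] c by (simp add: lm_smult_assoc)
      finally have t: "f' w = ?t \<odot>\<^bsub>V\<^esub> f' v" .
      have "?t \<in> carrier K" using nonzero_inv(1)[OF d] c by simp
      then obtain b where b: "b \<in> carrier K" "\<theta>' b = ?t"
        using ring_iso_surj[OF semilinearD(1)[OF f']] by (metis imageE)
      have "f' w = f' (b \<odot>\<^bsub>V\<^esub> v)" using t b semilinearD(4)[OF f' b(1) v(1)] by simp
      then have "w = b \<odot>\<^bsub>V\<^esub> v" using inj(2) w(1) lm_smult_closed[OF b(1) v(1)] by (meson inj_onD)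
      then show False using w(2) b by (auto simp: line_def)
    qed
    have "?s \<odot>\<^bsub>V\<^esub> f' v = \<alpha> v \<odot>\<^bsub>V\<^esub> f' v"
      using sum c' unfolding sw by simp
    then have "?s = \<alpha> v" using smult_right_cancel nz(2)[OF v] c by simp
    then show ?thesis using sw by simp
  qed
  obtain u v where uv: "u \<in> carrier V" "v \<in> carrier V" "v \<noteq> \<zero>\<^bsub>V\<^esub>" "u \<notin> line v"
    using rank_ge_two_off_line[OF rank] .
  have const: "\<alpha> w = \<alpha> v" if w: "w \<in> carrier V" "w \<noteq> \<zero>\<^bsub>V\<^esub>" for w
  proof (cases "w \<in> line v")
    case True
    then have "line w \<subseteq> line v"
      using line_submodule[OF uv(2)] unfolding submodule_iff by (auto simp: line_def[of w])
    then show ?thesis using indep[OF w uv(1)] indep[OF uv(2,3,1,4)] uv(4) by auto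
  qed (use indep[OF uv(2,3) w(1)] in auto)
  have "\<alpha> v \<noteq> \<zero>"
    using nz(1)[OF uv(2,3)] \<alpha>(2)[OF uv(2)] smult_zero_left[OF car(2)[OF uv(2)]] by auto
  moreover have "f w = \<alpha> v \<odot>\<^bsub>V\<^esub> f' w" if "w \<in> carrier V" for w
    using \<alpha>(1)[OF uv(2)] \<alpha>(2)[OF that] const[OF that] semilinear_zero[OF f] semilinear_zero[OF f']
      smult_zero_right by (cases "w = \<zero>\<^bsub>V\<^esub>") auto
  ultimately show thesis using that[of "\<alpha> v"] \<alpha>(1)[OF uv(2)] by auto
qed

text \<open>
  An ordered set with a top element and all nonempty infima is a complete lattice, and
  intersections provide the infima.
\<close>

lemma submodule_lattice_is_lattice: "lattice (submodule_lattice K V)" (is "lattice ?L")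
proof -
  interpret L: partial_order ?L
    by unfold_locales (auto simp: submodule_lattice_def)
  have "complete_lattice ?L"
  proof (rule L.complete_lattice_criterion1)
    show "\<exists>g. greatest ?L g (carrier ?L)"
      using carrier_submodule submodule_iff unfolding greatest_def
      by (intro exI[of _ "carrier V"]) (simp add: mem_submodule_lattice le_submodule_lattice)
  next
    fix A assume A: "A \<subseteq> carrier ?L" "A \<noteq> {}"
    have sub: "submodule W K V" if "W \<in> A" for W
      using A(1) that mem_submodule_lattice by blast
    obtain W where "W \<in> A" using A(2) by blast
    then have "\<Inter>A \<subseteq> carrier V" using sub[of W] unfolding submodule_iff by blast
    then have Int: "submodule (\<Inter>A) K V"
      using sub unfolding submodule_iff by simp
    have "greatest ?L (\<Inter>A) (Lower ?L A)"
    proof (unfold greatest_def, intro conjI ballI)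
      show "Lower ?L A \<subseteq> carrier ?L" by (rule Lower_closed)
      show "\<Inter>A \<in> Lower ?L A"
        using Int by (intro Lower_memI) (auto simp: mem_submodule_lattice le_submodule_lattice)
      show "W \<sqsubseteq>\<^bsub>?L\<^esub> \<Inter>A" if "W \<in> Lower ?L A" for W
        using Lower_memD[OF that _ A(1)] by (auto simp: le_submodule_lattice)
    qed
    then show "\<exists>i. greatest ?L i (Lower ?L A)" ..
  qed
  then interpret L: complete_lattice ?L .
  show ?thesis ..
qed

end

text \<open>
  An order isomorphism preserves meets and joins, and the group structure provides the inverse
  isomorphism. So an action by monotone maps is an action by lattice automorphisms.
\<close>

lemma G_latticeI_mono:
  assumes G: "group G" and L: "lattice L"
    and clo: "\<And>g m. g \<in> carrier G \<Longrightarrow> m \<in> carrier L \<Longrightarrow> act g m \<in> carrier L"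
    and comp: "\<And>g h m. g \<in> carrier G \<Longrightarrow> h \<in> carrier G \<Longrightarrow> m \<in> carrier L \<Longrightarrow>
      act g (act h m) = act (g \<otimes>\<^bsub>G\<^esub> h) m"
    and one: "\<And>m. m \<in> carrier L \<Longrightarrow> act \<one>\<^bsub>G\<^esub> m = m"
    and mono: "\<And>g m n. g \<in> carrier G \<Longrightarrow> m \<in> carrier L \<Longrightarrow> n \<in> carrier L \<Longrightarrow> m \<sqsubseteq>\<^bsub>L\<^esub> n \<Longrightarrow>
      act g m \<sqsubseteq>\<^bsub>L\<^esub> act g n"
  shows "G_lattice G L act"
proof -
  interpret G: group G by fact
  interpret L: lattice L by fact
  have inv: "act (inv\<^bsub>G\<^esub> g) (act g m) = m" "act g (act (inv\<^bsub>G\<^esub> g) m) = m"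
    if "g \<in> carrier G" "m \<in> carrier L" for g m
    using that comp one by simp_all
  have meet: "act g (m \<sqinter>\<^bsub>L\<^esub> n) = act g m \<sqinter>\<^bsub>L\<^esub> act g n"
    if g: "g \<in> carrier G" and mn: "m \<in> carrier L" "n \<in> carrier L" for g m n
  proof (rule L.le_antisym)
    let ?x = "act g m \<sqinter>\<^bsub>L\<^esub> act g n"
    have x: "?x \<in> carrier L" using clo g mn by simp
    have "act (inv\<^bsub>G\<^esub> g) ?x \<sqsubseteq>\<^bsub>L\<^esub> act (inv\<^bsub>G\<^esub> g) (act g m)"
      "act (inv\<^bsub>G\<^esub> g) ?x \<sqsubseteq>\<^bsub>L\<^esub> act (inv\<^bsub>G\<^esub> g) (act g n)"
      using mono[of "inv\<^bsub>G\<^esub> g" ?x] g mn x clo L.meet_left L.meet_right by auto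
    then have "act (inv\<^bsub>G\<^esub> g) ?x \<sqsubseteq>\<^bsub>L\<^esub> m \<sqinter>\<^bsub>L\<^esub> n"
      using inv g mn clo x by (intro L.meet_le) auto
    from mono[OF g _ _ this] show "?x \<sqsubseteq>\<^bsub>L\<^esub> act g (m \<sqinter>\<^bsub>L\<^esub> n)"
      using inv(2)[OF g x] g mn x clo by simp
    show "act g (m \<sqinter>\<^bsub>L\<^esub> n) \<sqsubseteq>\<^bsub>L\<^esub> ?x"
      using g mn clo mono L.meet_left L.meet_right by (intro L.meet_le) auto
  qed (use g mn clo in auto)
  have join: "act g (m \<squnion>\<^bsub>L\<^esub> n) = act g m \<squnion>\<^bsub>L\<^esub> act g n"
    if g: "g \<in> carrier G" and mn: "m \<in> carrier L" "n \<in> carrier L" for g m n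
  proof (rule L.le_antisym)
    let ?x = "act g m \<squnion>\<^bsub>L\<^esub> act g n"
    have x: "?x \<in> carrier L" using clo g mn by simp
    have "act (inv\<^bsub>G\<^esub> g) (act g m) \<sqsubseteq>\<^bsub>L\<^esub> act (inv\<^bsub>G\<^esub> g) ?x"
      "act (inv\<^bsub>G\<^esub> g) (act g n) \<sqsubseteq>\<^bsub>L\<^esub> act (inv\<^bsub>G\<^esub> g) ?x"
      using mono[of "inv\<^bsub>G\<^esub> g" _ ?x] g mn x clo L.join_left L.join_right by auto
    then have "m \<squnion>\<^bsub>L\<^esub> n \<sqsubseteq>\<^bsub>L\<^esub> act (inv\<^bsub>G\<^esub> g) ?x"
      using inv g mn clo x by (intro L.join_le) auto
    from mono[OF g _ _ this] show "act g (m \<squnion>\<^bsub>L\<^esub> n) \<sqsubseteq>\<^bsub>L\<^esub> ?x"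
      using inv(2)[OF g x] g mn x clo by simp
    show "?x \<sqsubseteq>\<^bsub>L\<^esub> act g (m \<squnion>\<^bsub>L\<^esub> n)"
      using g mn clo mono L.join_left L.join_right by (intro L.join_le) auto
  qed (use g mn clo in auto)
  have le_iff: "m \<sqsubseteq>\<^bsub>L\<^esub> n \<longleftrightarrow> act g m \<sqsubseteq>\<^bsub>L\<^esub> act g n"
    if g: "g \<in> carrier G" and mn: "m \<in> carrier L" "n \<in> carrier L" for g m n
  proof
    assume "act g m \<sqsubseteq>\<^bsub>L\<^esub> act g n"
    from mono[OF _ _ _ this, of "inv\<^bsub>G\<^esub> g"] show "m \<sqsubseteq>\<^bsub>L\<^esub> n"
      using inv(1)[OF g] mn clo[OF g] g by simp
  qed (rule mono[OF g mn])
  show ?thesis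
    unfolding G_lattice_def
  proof (intro conjI ballI)
    show "lattice L" by fact
  qed (rule clo comp one le_iff meet join; assumption)+
qed


section \<open>The extension determined by a lattice\<close>

context skew_module
begin

lemma semilinear_comp:
  assumes "semilinear K V \<theta> f" "semilinear K V \<theta>' f'"
  shows "semilinear K V (\<theta> \<circ> \<theta>') (f \<circ> f')"
  unfolding semilinear_def
  using semilinearD[OF assms(1)] semilinearD[OF assms(2)] ring_isoD(1)[of \<theta>' K]
  by (auto intro: ring_iso_set_trans)

text \<open>
  The cocycle identity is associativity of composition: both sides are the scalar that relates
  \<open>\<rho> g \<circ> \<rho> h \<circ> \<rho> k\<close> to \<open>\<rho> (g h k)\<close>.
\<close>

lemma factor_system_of_rep:
  assumes G: "group G" and v: "v \<in> carrier V" "v \<noteq> \<zero>\<^bsub>V\<^esub>"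
    and rep: "semilinear_rep K G V \<rho>" and assoc: "rep_associated K G V \<rho> \<chi> c"
    and c: "\<And>g h. g \<in> carrier G \<Longrightarrow> h \<in> carrier G \<Longrightarrow> c g h \<in> K\<^sup>*"
  shows "factor_system K G \<chi> c"
proof -
  interpret G: group G by fact
  have sl: "semilinear K V (\<chi> g) (\<rho> g)" if "g \<in> carrier G" for g
    using assoc that unfolding rep_associated_def by blast
  have comp: "\<rho> g (\<rho> h x) = c g h \<odot>\<^bsub>V\<^esub> \<rho> (g \<otimes>\<^bsub>G\<^esub> h) x"
    if "g \<in> carrier G" "h \<in> carrier G" "x \<in> carrier V" for g h x
    using assoc that unfolding rep_associated_def by blast
  have one: "\<rho> \<one>\<^bsub>G\<^esub> x = x" if "x \<in> carrier V" for x
    using rep that unfolding semilinear_rep_def by blast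
  have nz: "\<rho> g v \<noteq> \<zero>\<^bsub>V\<^esub>" if g: "g \<in> carrier G" for g
  proof -
    have "inj_on (\<rho> g) (carrier V)"
      using rep g unfolding semilinear_rep_def SGL_def bij_betw_def by blast
    then show ?thesis using semilinear_zero[OF sl[OF g]] v by (metis M.zero_closed inj_onD)
  qed
  have cK: "c g h \<in> carrier K" if "g \<in> carrier G" "h \<in> carrier G" for g h
    using c that by blast
  have chiK: "\<chi> g a \<in> carrier K" if "g \<in> carrier G" "a \<in> carrier K" for g a
    using ring_isoD(1)[OF semilinearD(1)[OF sl]] that by blast
  have conj: "\<chi> g (\<chi> h a) = c g h \<otimes> \<chi> (g \<otimes>\<^bsub>G\<^esub> h) a \<otimes> inv (c g h)"
    if g: "g \<in> carrier G" and h: "h \<in> carrier G" and a: "a \<in> carrier K" for g h a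
  proof -
    have gh: "g \<otimes>\<^bsub>G\<^esub> h \<in> carrier G" using g h by simp
    have "(\<chi> g \<circ> \<chi> h) a \<otimes> c g h = c g h \<otimes> \<chi> (g \<otimes>\<^bsub>G\<^esub> h) a"
      by (rule semilinear_scalars_conj[OF semilinear_comp[OF sl[OF g] sl[OF h]] sl[OF gh]
            cK[OF g h] _ v(1) nz[OF gh] a]) (simp add: comp g h)
    then show ?thesis
      using nonzero_inv[OF c[OF g h]] cK[OF g h] chiK g h a
        R.m_assoc[of "\<chi> g (\<chi> h a)" "c g h" "inv (c g h)"] by simp
  qed
  have cocycle: "c g h \<otimes> c (g \<otimes>\<^bsub>G\<^esub> h) k = \<chi> g (c h k) \<otimes> c g (h \<otimes>\<^bsub>G\<^esub> k)"
    if g: "g \<in> carrier G" and h: "h \<in> carrier G" and k: "k \<in> carrier G" for g h k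
  proof (rule smult_right_cancel)
    let ?w = "\<rho> (g \<otimes>\<^bsub>G\<^esub> h \<otimes>\<^bsub>G\<^esub> k) v"
    show w: "?w \<in> carrier V" using semilinearD(2)[OF sl] g h k v by simp
    show "?w \<noteq> \<zero>\<^bsub>V\<^esub>" using nz g h k by simp
    have kv: "\<rho> k v \<in> carrier V" "\<rho> (h \<otimes>\<^bsub>G\<^esub> k) v \<in> carrier V"
      using semilinearD(2)[OF sl] h k v by simp_all
    have "(c g h \<otimes> c (g \<otimes>\<^bsub>G\<^esub> h) k) \<odot>\<^bsub>V\<^esub> ?w = \<rho> g (\<rho> h (\<rho> k v))"
      using comp[of g h "\<rho> k v"] comp[of "g \<otimes>\<^bsub>G\<^esub> h" k v] lm_smult_assoc g h k v cK kv w by simp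
    also have "\<dots> = \<chi> g (c h k) \<odot>\<^bsub>V\<^esub> \<rho> g (\<rho> (h \<otimes>\<^bsub>G\<^esub> k) v)"
      using comp[of h k v] semilinearD(4)[OF sl[OF g] cK[OF h k] kv(2)] h k v by simp
    also have "\<dots> = (\<chi> g (c h k) \<otimes> c g (h \<otimes>\<^bsub>G\<^esub> k)) \<odot>\<^bsub>V\<^esub> ?w"
      using comp[of g "h \<otimes>\<^bsub>G\<^esub> k" v] lm_smult_assoc g h k v cK chiK w by (simp add: G.m_assoc)
    finally show "(c g h \<otimes> c (g \<otimes>\<^bsub>G\<^esub> h) k) \<odot>\<^bsub>V\<^esub> ?w
      = (\<chi> g (c h k) \<otimes> c g (h \<otimes>\<^bsub>G\<^esub> k)) \<odot>\<^bsub>V\<^esub> ?w" .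
  qed (use g h k cK chiK in simp_all)
  have "c \<one>\<^bsub>G\<^esub> \<one>\<^bsub>G\<^esub> = \<one>"
    using comp[of "\<one>\<^bsub>G\<^esub>" "\<one>\<^bsub>G\<^esub>" v] one[OF v(1)] lm_smult_one[OF v(1)] v cK[of "\<one>\<^bsub>G\<^esub>" "\<one>\<^bsub>G\<^esub>"]
    by (intro smult_right_cancel[OF _ v]) simp_all
  moreover have "\<chi> \<in> carrier G \<rightarrow> ring_iso K K"
    using semilinearD(1)[OF sl] by blast
  moreover have "c \<in> carrier G \<rightarrow> carrier G \<rightarrow> K\<^sup>*" using c by blast
  ultimately show ?thesis
    unfolding factor_system_def using conj cocycle by simp
qed

text \<open>
  Coordinatizability promises a semilinear map only. It is bijective because the lattice map is:
  a vector in the kernel spans a line with the image of \<open>0\<close>, and the image of the map is the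
  image of the top element.
\<close>

lemma coordinatization_bij:
  assumes G: "group G" and L: "G_lattice G (submodule_lattice K V) act" and g: "g \<in> carrier G"
    and f: "semilinear K V \<theta> f" and act: "\<And>W. submodule W K V \<Longrightarrow> act g W = f ` W"
  shows "bij_betw f (carrier V) (carrier V)"
proof -
  interpret G: group G by fact
  have le_iff: "U \<subseteq> W \<longleftrightarrow> act g U \<subseteq> act g W" if "submodule U K V" "submodule W K V" for U W
    using L g that unfolding G_lattice_def by (simp add: mem_submodule_lattice le_submodule_lattice)
  have clo: "submodule (act h W) K V" if "h \<in> carrier G" "submodule W K V" for h W
    using L that unfolding G_lattice_def by (simp add: mem_submodule_lattice)
  have "act g (act (inv\<^bsub>G\<^esub> g) (carrier V)) = carrier V"
    using L g carrier_submodule unfolding G_lattice_def by (simp add: mem_submodule_lattice)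
  moreover have "act (inv\<^bsub>G\<^esub> g) (carrier V) \<subseteq> carrier V"
    using clo[OF _ carrier_submodule, of "inv\<^bsub>G\<^esub> g"] g unfolding submodule_iff by simp
  ultimately have "carrier V \<subseteq> f ` carrier V"
    using act[OF clo[OF G.inv_closed[OF g] carrier_submodule]] by blast
  then have surj: "f ` carrier V = carrier V"
    using semilinearD(2)[OF f] by blast
  have kernel: "d = \<zero>\<^bsub>V\<^esub>" if d: "d \<in> carrier V" "f d = \<zero>\<^bsub>V\<^esub>" for d
  proof -
    have "f ` line d \<subseteq> f ` {\<zero>\<^bsub>V\<^esub>}"
      using d semilinearD(4)[OF f _ d(1)] semilinear_zero[OF f] smult_zero_right
        ring_isoD(1)[OF semilinearD(1)[OF f]]
      by (auto simp: line_def)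
    then have "line d \<subseteq> {\<zero>\<^bsub>V\<^esub>}"
      using le_iff[OF line_submodule[OF d(1)] zero_submodule] act line_submodule[OF d(1)]
        zero_submodule by simp
    then show ?thesis using mem_line_self[OF d(1)] by blast
  qed
  have "inj_on f (carrier V)"
  proof (rule inj_onI)
    fix x y assume xy: "x \<in> carrier V" "y \<in> carrier V" "f x = f y"
    have eq: "x \<ominus>\<^bsub>V\<^esub> y \<oplus>\<^bsub>V\<^esub> y = x"
      using xy by (simp add: a_minus_def M.a_assoc M.l_neg)
    then have "f (x \<ominus>\<^bsub>V\<^esub> y) \<oplus>\<^bsub>V\<^esub> f y = f y"
      using semilinearD(3)[OF f, of "x \<ominus>\<^bsub>V\<^esub> y" y] xy by simp
    then have "f (x \<ominus>\<^bsub>V\<^esub> y) = \<zero>\<^bsub>V\<^esub>"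
      using semilinearD(2)[OF f] xy by (metis M.add.r_cancel_one M.minus_closed)
    then have "x \<ominus>\<^bsub>V\<^esub> y = \<zero>\<^bsub>V\<^esub>" using kernel xy by simp
    then show "x = y" using eq xy by simp
  qed
  then show ?thesis using surj by (simp add: bij_betw_def)
qed

text \<open>
  Choose a coordinatization \<open>\<rho> g\<close> of every \<open>g\<close>, the identity for the neutral element. Then
  \<open>\<rho> g \<circ> \<rho> h\<close> and \<open>\<rho> (g h)\<close> coordinatize the same lattice map and differ by a scalar.
\<close>

lemma lattice_determines_rep:
  assumes G: "group G" and rank: "rank_at_least K V 2"
    and L: "G_lattice G (submodule_lattice K V) act"
    and coord: "\<And>g. g \<in> carrier G \<Longrightarrow> coordinatizable K V (act g)"
  obtains \<rho> \<chi> c where "factor_system K G \<chi> c" "semilinear_rep K G V \<rho>"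
    "rep_determines K G V \<rho> act" "rep_associated K G V \<rho> \<chi> c"
proof -
  interpret G: group G by fact
  have act_comp: "act g (act h W) = act (g \<otimes>\<^bsub>G\<^esub> h) W"
    if "g \<in> carrier G" "h \<in> carrier G" "submodule W K V" for g h W
    using L that unfolding G_lattice_def by (simp add: mem_submodule_lattice)
  have act_one: "act \<one>\<^bsub>G\<^esub> W = W" if "submodule W K V" for W
    using L that unfolding G_lattice_def by (simp add: mem_submodule_lattice)
  define P where "P g f \<theta> \<longleftrightarrow> semilinear K V \<theta> f \<and>
    (\<forall>W. submodule W K V \<longrightarrow> act g W = f ` W) \<and> (g = \<one>\<^bsub>G\<^esub> \<longrightarrow> f = (\<lambda>x. x))" for g f \<theta>
  have "\<exists>f \<theta>. P g f \<theta>" if g: "g \<in> carrier G" for g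
  proof (cases "g = \<one>\<^bsub>G\<^esub>")
    case True
    have "semilinear K V (\<lambda>a. a) (\<lambda>x. x)"
      unfolding semilinear_def using ring_iso_set_refl[of K] by (simp add: id_def)
    then have "P g (\<lambda>x. x) (\<lambda>a. a)" unfolding P_def True image_ident using act_one by simp
    then show ?thesis by blast
  next
    case False
    then have "P g f \<theta> \<longleftrightarrow> semilinear K V \<theta> f \<and> (\<forall>W. submodule W K V \<longrightarrow> act g W = f ` W)" for f \<theta>
      unfolding P_def by simp
    then show ?thesis
      using coord[OF g] unfolding coordinatizable_def Ball_def mem_submodule_lattice by metis
  qed
  then obtain \<rho> \<chi> where "P g (\<rho> g) (\<chi> g)" if "g \<in> carrier G" for g
    by metis
  then have \<rho>: "semilinear K V (\<chi> g) (\<rho> g)" "submodule W K V \<Longrightarrow> act g W = \<rho> g ` W"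
    "g = \<one>\<^bsub>G\<^esub> \<Longrightarrow> \<rho> g = (\<lambda>x. x)" if "g \<in> carrier G" for g W
    using that unfolding P_def by blast+
  have bij: "bij_betw (\<rho> g) (carrier V) (carrier V)" if g: "g \<in> carrier G" for g
    by (rule coordinatization_bij[OF G L g \<rho>(1,2)[OF g]])
  have "\<exists>\<mu> \<in> K\<^sup>*. \<forall>x \<in> carrier V. \<rho> g (\<rho> h x) = \<mu> \<odot>\<^bsub>V\<^esub> \<rho> (g \<otimes>\<^bsub>G\<^esub> h) x"
    if g: "g \<in> carrier G" and h: "h \<in> carrier G" for g h
  proof -
    have gh: "g \<otimes>\<^bsub>G\<^esub> h \<in> carrier G" using g h by simp
    have inj: "inj_on (\<rho> g \<circ> \<rho> h) (carrier V)" "inj_on (\<rho> (g \<otimes>\<^bsub>G\<^esub> h)) (carrier V)"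
      using bij_betw_trans[OF bij[OF h] bij[OF g]] bij[OF gh] by (simp_all add: bij_betw_def)
    have same: "(\<rho> g \<circ> \<rho> h) ` W = \<rho> (g \<otimes>\<^bsub>G\<^esub> h) ` W" if W: "submodule W K V" for W
      using act_comp[OF g h W] \<rho>(2)[OF h W] \<rho>(2)[OF gh W]
        \<rho>(2)[OF g semilinear_image_submodule[OF \<rho>(1)[OF h] W]]
      by (simp add: image_comp)
    show ?thesis
      by (rule same_lattice_map_scalar[OF rank semilinear_comp[OF \<rho>(1)[OF g] \<rho>(1)[OF h]]
            \<rho>(1)[OF gh] inj same]) auto
  qed
  then obtain c where c: "c g h \<in> K\<^sup>*"
    "x \<in> carrier V \<Longrightarrow> \<rho> g (\<rho> h x) = c g h \<odot>\<^bsub>V\<^esub> \<rho> (g \<otimes>\<^bsub>G\<^esub> h) x"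
    if "g \<in> carrier G" "h \<in> carrier G" for g h x
    by metis
  have "\<rho> \<one>\<^bsub>G\<^esub> v = v" for v using \<rho>(3)[OF G.one_closed] by simp
  from semilinear_repI[where \<chi> = \<chi>, OF \<rho>(1) bij c this]
  have rep: "semilinear_rep K G V \<rho>" .
  have assoc: "rep_associated K G V \<rho> \<chi> c"
    unfolding rep_associated_def by (intro conjI ballI \<rho>(1) c(2))
  have det: "rep_determines K G V \<rho> act"
    unfolding rep_determines_def by (simp add: mem_submodule_lattice \<rho>(2))
  obtain v where "v \<in> carrier V" "v \<noteq> \<zero>\<^bsub>V\<^esub>"
    using rank_ge_two_off_line[OF rank] by blast
  from factor_system_of_rep[OF G this rep assoc c(1)] have "factor_system K G \<chi> c" .
  from that[OF this rep det assoc] show thesis .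
qed

text \<open>
  Two representations that determine the same lattice differ by scalars \<open>\<mu> g\<close>, and these scalars
  are the equivalence of the factor systems.
\<close>

lemma lattice_reps_equivalent:
  assumes G: "group G" and rank: "rank_at_least K V 2"
    and fs: "factor_system K G \<chi> c" and fs': "factor_system K G \<chi>' c'"
    and rep: "semilinear_rep K G V \<rho>" and rep': "semilinear_rep K G V \<rho>'"
    and det: "rep_determines K G V \<rho> act" and det': "rep_determines K G V \<rho>' act"
    and assoc: "rep_associated K G V \<rho> \<chi> c" and assoc': "rep_associated K G V \<rho>' \<chi>' c'"
  shows "factor_systems_equivalent K G \<chi> c \<chi>' c'"
proof -
  interpret G: group G by fact
  obtain v where v: "v \<in> carrier V" "v \<noteq> \<zero>\<^bsub>V\<^esub>"
    using rank_ge_two_off_line[OF rank] by blast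
  have sl: "semilinear K V (\<chi> g) (\<rho> g)" "semilinear K V (\<chi>' g) (\<rho>' g)" if "g \<in> carrier G" for g
    using assoc assoc' that unfolding rep_associated_def by blast+
  have comp: "\<rho> g (\<rho> h x) = c g h \<odot>\<^bsub>V\<^esub> \<rho> (g \<otimes>\<^bsub>G\<^esub> h) x"
    "\<rho>' g (\<rho>' h x) = c' g h \<odot>\<^bsub>V\<^esub> \<rho>' (g \<otimes>\<^bsub>G\<^esub> h) x"
    if "g \<in> carrier G" "h \<in> carrier G" "x \<in> carrier V" for g h x
    using assoc assoc' that unfolding rep_associated_def by blast+
  have inj: "inj_on (\<rho> g) (carrier V)" "inj_on (\<rho>' g) (carrier V)" if "g \<in> carrier G" for g
    using rep rep' that unfolding semilinear_rep_def SGL_def bij_betw_def by blast+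
  have same: "\<rho> g ` W = \<rho>' g ` W" if "g \<in> carrier G" "submodule W K V" for g W
    using det det' that unfolding rep_determines_def by (simp add: mem_submodule_lattice)
  have "\<exists>m \<in> K\<^sup>*. \<forall>x \<in> carrier V. \<rho> g x = m \<odot>\<^bsub>V\<^esub> \<rho>' g x" if g: "g \<in> carrier G" for g
    by (rule same_lattice_map_scalar[OF rank sl[OF g] inj[OF g] same[OF g]]) auto
  then obtain \<mu> where \<mu>: "\<mu> g \<in> K\<^sup>*" "x \<in> carrier V \<Longrightarrow> \<rho> g x = \<mu> g \<odot>\<^bsub>V\<^esub> \<rho>' g x"
    if "g \<in> carrier G" for g x
    by metis
  have \<mu>K: "\<mu> g \<in> carrier K" if "g \<in> carrier G" for g using \<mu>(1)[OF that] by blast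
  have cK: "c g h \<in> carrier K" "c' g h \<in> carrier K" if "g \<in> carrier G" "h \<in> carrier G" for g h
    using fs fs' that unfolding factor_system_def by (meson Pi_mem DiffD1)+
  have chiK: "\<chi> g a \<in> carrier K" "\<chi>' g a \<in> carrier K" if "g \<in> carrier G" "a \<in> carrier K" for g a
    using ring_isoD(1)[OF semilinearD(1)[OF sl(1)]] ring_isoD(1)[OF semilinearD(1)[OF sl(2)]] that
    by blast+
  have nz: "\<rho>' g v \<noteq> \<zero>\<^bsub>V\<^esub>" if "g \<in> carrier G" for g
    using inj(2)[OF that] semilinear_zero[OF sl(2)[OF that]] v by (metis M.zero_closed inj_onD)
  have conj: "\<chi>' g a = inv (\<mu> g) \<otimes> \<chi> g a \<otimes> \<mu> g" if g: "g \<in> carrier G" and a: "a \<in> carrier K" for g a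
  proof -
    have "\<chi> g a \<otimes> \<mu> g = \<mu> g \<otimes> \<chi>' g a"
      by (rule semilinear_scalars_conj[OF sl[OF g] \<mu>K[OF g] \<mu>(2)[OF g] v(1) nz[OF g] a])
    then have "inv (\<mu> g) \<otimes> \<chi> g a \<otimes> \<mu> g = inv (\<mu> g) \<otimes> \<mu> g \<otimes> \<chi>' g a"
      using nonzero_inv(1)[OF \<mu>(1)[OF g]] \<mu>K[OF g] chiK[OF g a] by (simp add: R.m_assoc)
    then show ?thesis using nonzero_inv(2)[OF \<mu>(1)[OF g]] chiK[OF g a] by simp
  qed
  have coc: "c g h \<otimes> \<mu> (g \<otimes>\<^bsub>G\<^esub> h) = \<mu> g \<otimes> \<chi>' g (\<mu> h) \<otimes> c' g h"
    if g: "g \<in> carrier G" and h: "h \<in> carrier G" for g h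
  proof (rule smult_right_cancel)
    let ?w = "\<rho>' (g \<otimes>\<^bsub>G\<^esub> h) v"
    show w: "?w \<in> carrier V" using semilinearD(2)[OF sl(2)] g h v by simp
    show "?w \<noteq> \<zero>\<^bsub>V\<^esub>" using nz g h by simp
    have hv: "\<rho>' h v \<in> carrier V" "\<rho> h v \<in> carrier V" "\<rho>' g (\<rho>' h v) \<in> carrier V"
      using semilinearD(2)[OF sl(2)] semilinearD(2)[OF sl(1)] g h v by simp_all
    have "(c g h \<otimes> \<mu> (g \<otimes>\<^bsub>G\<^esub> h)) \<odot>\<^bsub>V\<^esub> ?w = \<rho> g (\<rho> h v)"
      using comp(1)[OF g h v(1)] \<mu>(2)[of "g \<otimes>\<^bsub>G\<^esub> h" v] \<mu>K cK g h v w
      by (simp add: lm_smult_assoc)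
    also have "\<dots> = \<mu> g \<odot>\<^bsub>V\<^esub> \<rho>' g (\<mu> h \<odot>\<^bsub>V\<^esub> \<rho>' h v)"
      using \<mu>(2)[OF g hv(2)] \<mu>(2)[OF h v(1)] by simp
    also have "\<dots> = \<mu> g \<odot>\<^bsub>V\<^esub> (\<chi>' g (\<mu> h) \<odot>\<^bsub>V\<^esub> (c' g h \<odot>\<^bsub>V\<^esub> ?w))"
      using semilinearD(4)[OF sl(2)[OF g] \<mu>K[OF h] hv(1)] comp(2)[OF g h v(1)] by simp
    also have "\<dots> = (\<mu> g \<otimes> \<chi>' g (\<mu> h) \<otimes> c' g h) \<odot>\<^bsub>V\<^esub> ?w"
      using \<mu>K cK chiK g h w by (simp add: lm_smult_assoc lm_smult_closed)
    finally show "(c g h \<otimes> \<mu> (g \<otimes>\<^bsub>G\<^esub> h)) \<odot>\<^bsub>V\<^esub> ?w = (\<mu> g \<otimes> \<chi>' g (\<mu> h) \<otimes> c' g h) \<odot>\<^bsub>V\<^esub> ?w" .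
  qed (use g h \<mu>K cK chiK in simp_all)
  have "\<mu> \<one>\<^bsub>G\<^esub> \<odot>\<^bsub>V\<^esub> v = \<one> \<odot>\<^bsub>V\<^esub> v"
    using \<mu>(2)[OF G.one_closed v(1)] rep rep' v(1) lm_smult_one unfolding semilinear_rep_def by simp
  then have "\<mu> \<one>\<^bsub>G\<^esub> = \<one>" using smult_right_cancel v \<mu>K by simp
  moreover have "\<mu> \<in> carrier G \<rightarrow> K\<^sup>*" using \<mu>(1) by blast
  ultimately show ?thesis
    unfolding factor_systems_equivalent_def using conj coc by (intro bexI[of _ \<mu>]) simp_all
qed


section \<open>The lattice of a representation\<close>

text \<open>
  Scalars act trivially on submodules, so a representation, though multiplicative only up to
  scalars, induces an honest action on the lattice.
\<close>

lemma lattice_of_rep: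
  assumes G: "group G" and fs: "factor_system K G \<chi> c"
    and assoc: "rep_associated K G V \<rho> \<chi> c"
    and one: "\<And>v. v \<in> carrier V \<Longrightarrow> \<rho> \<one>\<^bsub>G\<^esub> v = v"
  defines "act \<equiv> (\<lambda>g W. \<rho> g ` W)"
  shows "G_lattice G (submodule_lattice K V) act"
    and "g \<in> carrier G \<Longrightarrow> coordinatizable K V (act g)"
    and "extension_determined K G V act (extension K G \<chi> c)"
proof -
  interpret G: group G by fact
  have sl: "semilinear K V (\<chi> g) (\<rho> g)" if "g \<in> carrier G" for g
    using assoc that unfolding rep_associated_def by blast
  have comp: "\<rho> g (\<rho> h x) = c g h \<odot>\<^bsub>V\<^esub> \<rho> (g \<otimes>\<^bsub>G\<^esub> h) x"
    if "g \<in> carrier G" "h \<in> carrier G" "x \<in> carrier V" for g h x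
    using assoc that unfolding rep_associated_def by blast
  have c: "c g h \<in> K\<^sup>*" if "g \<in> carrier G" "h \<in> carrier G" for g h
    using fs that unfolding factor_system_def by (meson Pi_mem)
  have inv_comp: "\<rho> (inv\<^bsub>G\<^esub> g) (\<rho> g x) = c (inv\<^bsub>G\<^esub> g) g \<odot>\<^bsub>V\<^esub> x"
    "\<rho> g (\<rho> (inv\<^bsub>G\<^esub> g) x) = c g (inv\<^bsub>G\<^esub> g) \<odot>\<^bsub>V\<^esub> x" if "g \<in> carrier G" "x \<in> carrier V" for g x
    using comp[of "inv\<^bsub>G\<^esub> g" g x] comp[of g "inv\<^bsub>G\<^esub> g" x] one that by simp_all
  have bij: "bij_betw (\<rho> g) (carrier V) (carrier V)" if g: "g \<in> carrier G" for g
  proof -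
    have g': "inv\<^bsub>G\<^esub> g \<in> carrier G" using g by simp
    have "inj_on (\<rho> g) (carrier V)"
      using inv_comp(1)[OF g] smult_left_cancel[OF _ c[OF g' g]] by (metis inj_onI)
    moreover have "y \<in> \<rho> g ` carrier V" if y: "y \<in> carrier V" for y
    proof -
      let ?a = "c g (inv\<^bsub>G\<^esub> g)"
      have a: "?a \<in> K\<^sup>*" by (rule c[OF g g'])
      have x: "inv ?a \<odot>\<^bsub>V\<^esub> y \<in> carrier V" using nonzero_inv(1)[OF a] y lm_smult_closed by blast
      have "\<rho> g (\<rho> (inv\<^bsub>G\<^esub> g) (inv ?a \<odot>\<^bsub>V\<^esub> y)) = y"
        using inv_comp(2)[OF g x] lm_smult_assoc[of ?a "inv ?a" y] nonzero_inv[OF a] a y lm_smult_one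
        by auto
      then show ?thesis using semilinearD(2)[OF sl[OF g'] x] by (metis imageI)
    qed
    ultimately show ?thesis using semilinearD(2)[OF sl[OF g]] by (auto simp: bij_betw_def)
  qed
  have act_comp: "act g (act h W) = act (g \<otimes>\<^bsub>G\<^esub> h) W"
    if g: "g \<in> carrier G" and h: "h \<in> carrier G" and W: "submodule W K V" for g h W
  proof -
    have "W \<subseteq> carrier V" using W unfolding submodule_iff by blast
    then have "act g (act h W) = (\<lambda>y. c g h \<odot>\<^bsub>V\<^esub> y) ` \<rho> (g \<otimes>\<^bsub>G\<^esub> h) ` W"
      unfolding act_def image_image using comp[OF g h] by (intro image_cong) auto
    then show ?thesis
      using smult_image_submodule[OF semilinear_image_submodule[OF sl W] c[OF g h]] g h
      unfolding act_def by simp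
  qed
  show "G_lattice G (submodule_lattice K V) act"
  proof (rule G_latticeI_mono[OF G submodule_lattice_is_lattice])
    show "act \<one>\<^bsub>G\<^esub> W = W" if "W \<in> carrier (submodule_lattice K V)" for W
    proof -
      have "W \<subseteq> carrier V" using that unfolding mem_submodule_lattice submodule_iff by blast
      then have "\<rho> \<one>\<^bsub>G\<^esub> ` W = (\<lambda>x. x) ` W" using one by (intro image_cong) auto
      then show ?thesis by (simp add: act_def)
    qed
  qed (use semilinear_image_submodule[OF sl] act_comp in
      \<open>auto simp: mem_submodule_lattice le_submodule_lattice act_def\<close>)
  show "coordinatizable K V (act g)" if "g \<in> carrier G"
    using sl[OF that] unfolding coordinatizable_def act_def by blast
  have "semilinear_rep K G V \<rho>"
    by (rule semilinear_repI[where \<chi> = \<chi>, OF sl bij c comp one])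
  moreover have "rep_determines K G V \<rho> act"
    unfolding rep_determines_def act_def by blast
  ultimately show "extension_determined K G V act (extension K G \<chi> c)"
    unfolding extension_determined_def using fs assoc by blast
qed

end


section \<open>Free modules\<close>

text \<open>
  Functions of finite support. A module record extends a ring record, which asks for a product of
  vectors and its unit; both are left undefined.
\<close>

definition free_module :: "('k, 'm) ring_scheme \<Rightarrow> 'i set \<Rightarrow> ('k, 'i \<Rightarrow> 'k) module" where
  "free_module K I =
     \<lparr>carrier = {f. (\<forall>p. f p \<in> carrier K) \<and> {p. f p \<noteq> \<zero>\<^bsub>K\<^esub>} \<subseteq> I \<and> finite {p. f p \<noteq> \<zero>\<^bsub>K\<^esub>}},
      monoid.mult = undefined, one = undefined,
      ring.zero = (\<lambda>_. \<zero>\<^bsub>K\<^esub>), ring.add = (\<lambda>f g p. f p \<oplus>\<^bsub>K\<^esub> g p),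
      module.smult = (\<lambda>a f p. a \<otimes>\<^bsub>K\<^esub> f p)\<rparr>"

definition unit_vector :: "('k, 'm) ring_scheme \<Rightarrow> 'i \<Rightarrow> 'i \<Rightarrow> 'k" where
  "unit_vector K p = (\<lambda>q. if q = p then \<one>\<^bsub>K\<^esub> else \<zero>\<^bsub>K\<^esub>)"

lemma free_module_simps [simp]:
  "\<zero>\<^bsub>free_module K I\<^esub> = (\<lambda>_. \<zero>\<^bsub>K\<^esub>)"
  "f \<oplus>\<^bsub>free_module K I\<^esub> g = (\<lambda>p. f p \<oplus>\<^bsub>K\<^esub> g p)"
  "a \<odot>\<^bsub>free_module K I\<^esub> f = (\<lambda>p. a \<otimes>\<^bsub>K\<^esub> f p)"
  by (simp_all add: free_module_def)

lemma mem_free_module: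
  "f \<in> carrier (free_module K I) \<longleftrightarrow>
     (\<forall>p. f p \<in> carrier K) \<and> {p. f p \<noteq> \<zero>\<^bsub>K\<^esub>} \<subseteq> I \<and> finite {p. f p \<noteq> \<zero>\<^bsub>K\<^esub>}"
  by (simp add: free_module_def)

context ring
begin

lemma free_module_supportI:
  assumes "\<And>p. f p \<in> carrier R" "{p. f p \<noteq> \<zero>} \<subseteq> S" "finite S" "S \<subseteq> I"
  shows "f \<in> carrier (free_module R I)"
  using assms finite_subset unfolding mem_free_module by blast

lemma free_module_left_module: "left_module R (free_module R I)" (is "left_module R ?V")
proof (intro left_module.intro left_module_axioms.intro)
  show "ring R" by (rule ring_axioms)
  have car: "f p \<in> carrier R" if "f \<in> carrier ?V" for f p
    using that by (simp add: mem_free_module)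
  show "abelian_group ?V"
  proof (rule abelian_groupI)
    fix f g assume f: "f \<in> carrier ?V" and g: "g \<in> carrier ?V"
    show "f \<oplus>\<^bsub>?V\<^esub> g \<in> carrier ?V"
      by (rule free_module_supportI[of _ "{p. f p \<noteq> \<zero>} \<union> {p. g p \<noteq> \<zero>}"])
        (use f g in \<open>auto simp: mem_free_module\<close>)
  next
    fix f assume f: "f \<in> carrier ?V"
    have "(\<lambda>p. \<ominus> f p) \<in> carrier ?V"
      by (rule free_module_supportI[of _ "{p. f p \<noteq> \<zero>}"]) (use f in \<open>auto simp: mem_free_module\<close>)
    then show "\<exists>g \<in> carrier ?V. g \<oplus>\<^bsub>?V\<^esub> f = \<zero>\<^bsub>?V\<^esub>"
      using car[OF f] by (auto simp: l_neg intro!: bexI[of _ "\<lambda>p. \<ominus> f p"])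
  qed (auto simp: fun_eq_iff car a_ac mem_free_module[of "\<lambda>_. \<zero>"])
  show "a \<odot>\<^bsub>?V\<^esub> f \<in> carrier ?V" if "a \<in> carrier R" "f \<in> carrier ?V" for a f
    by (rule free_module_supportI[of _ "{p. f p \<noteq> \<zero>}"]) (use that in \<open>auto simp: mem_free_module\<close>)
qed (auto simp: fun_eq_iff mem_free_module l_distr r_distr m_assoc)

lemma unit_vector_mem: "p \<in> I \<Longrightarrow> unit_vector R p \<in> carrier (free_module R I)"
  by (rule free_module_supportI[of _ "{p}"]) (auto simp: unit_vector_def)

lemma inj_unit_vector: "\<one> \<noteq> \<zero> \<Longrightarrow> inj (unit_vector R)"
  unfolding inj_def unit_vector_def by metis

text \<open>
  The coordinates of a linear combination of unit vectors are its coefficients. Spanning and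
  independence both follow.
\<close>

lemma finsum_unit_vectors:
  assumes nontriv: "\<one> \<noteq> \<zero>" and T: "finite T" "T \<subseteq> I"
    and a: "\<And>p. p \<in> T \<Longrightarrow> a (unit_vector R p) \<in> carrier R"
  shows "(\<Oplus>\<^bsub>free_module R I\<^esub> b \<in> unit_vector R ` T. a b \<odot>\<^bsub>free_module R I\<^esub> b) =
    (\<lambda>q. if q \<in> T then a (unit_vector R q) else \<zero>)"
proof -
  interpret V: left_module R "free_module R I" by (rule free_module_left_module)
  show ?thesis
    using T a
  proof (induction T rule: finite_induct)
    case empty
    show ?case unfolding image_empty V.M.finsum_empty by simp
  next
    case (insert p T)
    let ?V = "free_module R I"
    have mem: "a (unit_vector R q) \<odot>\<^bsub>?V\<^esub> unit_vector R q \<in> carrier ?V" if "q \<in> insert p T" for q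
      by (rule V.lm_smult_closed[OF insert.prems(2)[OF that] unit_vector_mem])
        (use insert.prems(1) that in blast)
    have "unit_vector R p \<notin> unit_vector R ` T"
      using inj_image_mem_iff[OF inj_unit_vector[OF nontriv], of p T] insert.hyps(2) by simp
    then have "(\<Oplus>\<^bsub>?V\<^esub> b \<in> unit_vector R ` insert p T. a b \<odot>\<^bsub>?V\<^esub> b) =
      a (unit_vector R p) \<odot>\<^bsub>?V\<^esub> unit_vector R p \<oplus>\<^bsub>?V\<^esub> (\<Oplus>\<^bsub>?V\<^esub> b \<in> unit_vector R ` T. a b \<odot>\<^bsub>?V\<^esub> b)"
      using mem insert.hyps(1) unfolding image_insert by (intro V.M.finsum_insert) auto
    also have "(\<Oplus>\<^bsub>?V\<^esub> b \<in> unit_vector R ` T. a b \<odot>\<^bsub>?V\<^esub> b) =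
      (\<lambda>q. if q \<in> T then a (unit_vector R q) else \<zero>)"
      using insert by simp
    also have "a (unit_vector R p) \<odot>\<^bsub>?V\<^esub> unit_vector R p \<oplus>\<^bsub>?V\<^esub> \<dots> =
      (\<lambda>q. if q \<in> insert p T then a (unit_vector R q) else \<zero>)"
      (is "?l = ?r")
    proof
      fix q
      have "unit_vector R p q = (if q = p then \<one> else \<zero>)" by (simp add: unit_vector_def)
      then show "?l q = ?r q" using insert.hyps(2) insert.prems(2) by auto
    qed
    finally show ?case .
  qed
qed

lemma free_module_basis:
  assumes nontriv: "\<one> \<noteq> \<zero>"
  shows "is_basis R (free_module R I) (unit_vector R ` I)"
proof -
  let ?V = "free_module R I" and ?e = "unit_vector R"
  have inv: "inv_into UNIV ?e (?e p) = p" for p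
    using inj_unit_vector[OF nontriv] by (rule inv_f_f)
  have span: "\<exists>S a. finite S \<and> S \<subseteq> ?e ` I \<and> a \<in> S \<rightarrow> carrier R \<and> f = (\<Oplus>\<^bsub>?V\<^esub> b \<in> S. a b \<odot>\<^bsub>?V\<^esub> b)"
    if f: "f \<in> carrier ?V" for f
  proof -
    let ?T = "{p. f p \<noteq> \<zero>}" and ?a = "\<lambda>b. f (inv_into UNIV ?e b)"
    have T: "finite ?T" "?T \<subseteq> I" "\<And>p. f p \<in> carrier R" using f by (auto simp: mem_free_module)
    have "(\<Oplus>\<^bsub>?V\<^esub> b \<in> ?e ` ?T. ?a b \<odot>\<^bsub>?V\<^esub> b) = (\<lambda>q. if q \<in> ?T then ?a (?e q) else \<zero>)"
      using T by (intro finsum_unit_vectors[OF nontriv]) auto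
    also have "\<dots> = f" by (auto simp: inv)
    finally have "f = (\<Oplus>\<^bsub>?V\<^esub> b \<in> ?e ` ?T. ?a b \<odot>\<^bsub>?V\<^esub> b)" by (rule sym)
    moreover have "finite (?e ` ?T)" "?e ` ?T \<subseteq> ?e ` I" "?a \<in> ?e ` ?T \<rightarrow> carrier R"
      using T by auto
    ultimately show ?thesis by blast
  qed
  have indep: "\<forall>b \<in> S. a b = \<zero>"
    if S: "finite S" "S \<subseteq> ?e ` I" "a \<in> S \<rightarrow> carrier R"
      and zero: "(\<Oplus>\<^bsub>?V\<^esub> b \<in> S. a b \<odot>\<^bsub>?V\<^esub> b) = \<zero>\<^bsub>?V\<^esub>" for S a
  proof -
    obtain T where T: "T \<subseteq> I" "finite T" "S = ?e ` T"
      using finite_subset_image[OF S(1,2)] by metis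
    have "(\<Oplus>\<^bsub>?V\<^esub> b \<in> S. a b \<odot>\<^bsub>?V\<^esub> b) = (\<lambda>q. if q \<in> T then a (?e q) else \<zero>)"
      unfolding T(3) using T S(3) by (intro finsum_unit_vectors[OF nontriv]) auto
    then have "(if q \<in> T then a (?e q) else \<zero>) = \<zero>" for q
      using zero by (metis free_module_simps(1))
    then show ?thesis using T(3) by (metis imageE)
  qed
  show ?thesis
    unfolding is_basis_def
  proof (intro conjI ballI allI impI)
    show "?e ` I \<subseteq> carrier ?V" using unit_vector_mem by (rule image_subsetI)
    show "a b = \<zero>" if "finite S \<and> S \<subseteq> ?e ` I \<and> a \<in> S \<rightarrow> carrier R \<and>
      (\<Oplus>\<^bsub>?V\<^esub> b \<in> S. a b \<odot>\<^bsub>?V\<^esub> b) = \<zero>\<^bsub>?V\<^esub>" "b \<in> S" for S a b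
      using indep[of S a] that by simp
  qed (rule span)
qed

lemma free_module_rank:
  assumes "\<one> \<noteq> \<zero>" "infinite I \<or> n \<le> card I"
  shows "rank_at_least R (free_module R I) n"
proof -
  have "inj_on (unit_vector R) I"
    using inj_unit_vector[OF assms(1)] by (rule inj_on_subset) simp
  then show ?thesis
    unfolding rank_at_least_def
    using free_module_basis[OF assms(1), of I] assms(2) card_image finite_image_iff by metis
qed

end


section \<open>Crossed products\<close>

text \<open>
  Left multiplication by the basis vector \<open>u\<^sub>g\<close> in the crossed product of \<open>K\<close> and \<open>G\<close>, of which \<open>i\<close>
  counts several copies. The product of \<open>u\<^sub>g\<close> and \<open>a u\<^sub>h\<close> is
  \<open>\<chi> g a \<cdot> [g, h] u\<^sub>g\<^sub>h\<close>, so the coefficient at \<open>k\<close> comes from \<open>h = g\<^sup>-\<^sup>1 k\<close>.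
\<close>

definition twisted_translation ::
  "('k, 'm) ring_scheme \<Rightarrow> ('g, 'h) monoid_scheme \<Rightarrow> ('g \<Rightarrow> 'k \<Rightarrow> 'k) \<Rightarrow> ('g \<Rightarrow> 'g \<Rightarrow> 'k)
     \<Rightarrow> 'g \<Rightarrow> ('g \<times> nat \<Rightarrow> 'k) \<Rightarrow> 'g \<times> nat \<Rightarrow> 'k" where
  "twisted_translation K G \<chi> c g f =
     (\<lambda>(k, i). if k \<in> carrier G
        then \<chi> g (f (inv\<^bsub>G\<^esub> g \<otimes>\<^bsub>G\<^esub> k, i)) \<otimes>\<^bsub>K\<^esub> c g (inv\<^bsub>G\<^esub> g \<otimes>\<^bsub>G\<^esub> k) else \<zero>\<^bsub>K\<^esub>)"

lemma factor_system_normalized: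
  assumes K: "skew_field K" and G: "group G" and fs: "factor_system K G \<chi> c"
  shows "a \<in> carrier K \<Longrightarrow> \<chi> \<one>\<^bsub>G\<^esub> a = a" and "g \<in> carrier G \<Longrightarrow> c \<one>\<^bsub>G\<^esub> g = \<one>\<^bsub>K\<^esub>"
proof -
  interpret K: skew_field K by fact
  interpret G: group G by fact
  interpret H: group "extension K G \<chi> c" by (rule extension_is_group[OF K G fs])
  have chi: "\<chi> \<one>\<^bsub>G\<^esub> \<in> ring_iso K K" using fs by (auto simp: factor_system_def)
  have one: "\<one>\<^bsub>K\<^esub> \<in> carrier K - {\<zero>\<^bsub>K\<^esub>}" using K.skew_field_Units K.Units_one_closed by auto
  have c: "c \<one>\<^bsub>G\<^esub> g \<in> carrier K" if "g \<in> carrier G" for g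
    using fs that unfolding factor_system_def by (meson Pi_mem DiffD1 G.one_closed)
  \<comment> \<open>Both equations express that \<open>(1, 1)\<close> is the left unit of the extension.\<close>
  have unit: "\<chi> \<one>\<^bsub>G\<^esub> a \<otimes>\<^bsub>K\<^esub> c \<one>\<^bsub>G\<^esub> g = a" if "a \<in> carrier K - {\<zero>\<^bsub>K\<^esub>}" "g \<in> carrier G" for a g
    using H.l_one[of "(a, g)"] that ring_isoD(1)[OF chi, of a] by (simp add: extension_def)
  show c1: "c \<one>\<^bsub>G\<^esub> g = \<one>\<^bsub>K\<^esub>" if "g \<in> carrier G" for g
    using unit[OF one that] ring_isoD(3)[OF chi K.one_closed] c[OF that] by simp
  show "\<chi> \<one>\<^bsub>G\<^esub> a = a" if "a \<in> carrier K"
  proof (cases "a = \<zero>\<^bsub>K\<^esub>")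
    case False
    then show ?thesis
      using unit[of a "\<one>\<^bsub>G\<^esub>"] c1[of "\<one>\<^bsub>G\<^esub>"] ring_isoD(1)[OF chi that] that by simp
  qed (use K.auto_zero[OF chi] in simp)
qed

text \<open>
  The law for products is the associativity \<open>u\<^sub>g (u\<^sub>h (a u\<^sub>m)) = (u\<^sub>g u\<^sub>h) (a u\<^sub>m)\<close> of the crossed product:
  the cocycle identity moves \<open>[g, h]\<close> next to \<open>\<chi> g (\<chi> h a)\<close>, and the conjugation law moves it to
  the front.
\<close>

lemma twisted_translation_rep:
  fixes K :: "('k, 'm) ring_scheme" and G :: "('g, 'h) monoid_scheme" and n :: nat
  assumes K: "skew_field K" and G: "group G" and fs: "factor_system K G \<chi> c"
  defines "V \<equiv> free_module K (carrier G \<times> {..<n})"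
  shows "rep_associated K G V (twisted_translation K G \<chi> c) \<chi> c"
    and "f \<in> carrier V \<Longrightarrow> twisted_translation K G \<chi> c \<one>\<^bsub>G\<^esub> f = f"
proof -
  interpret K: skew_field K by fact
  interpret G: group G by fact
  let ?\<rho> = "twisted_translation K G \<chi> c"
  have chi: "\<chi> g \<in> ring_iso K K" if "g \<in> carrier G" for g
    using fs that by (auto simp: factor_system_def)
  have c: "c g h \<in> carrier K - {\<zero>\<^bsub>K\<^esub>}" if "g \<in> carrier G" "h \<in> carrier G" for g h
    using fs that unfolding factor_system_def by (meson Pi_mem)
  have cK: "c g h \<in> carrier K" if "g \<in> carrier G" "h \<in> carrier G" for g h
    using c[OF that] by blast
  note chiK = ring_isoD(1)[OF chi]
  have conj: "\<chi> g (\<chi> h a) \<otimes>\<^bsub>K\<^esub> c g h = c g h \<otimes>\<^bsub>K\<^esub> \<chi> (g \<otimes>\<^bsub>G\<^esub> h) a"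
    if g: "g \<in> carrier G" and h: "h \<in> carrier G" and a: "a \<in> carrier K" for g h a
  proof -
    have "\<chi> g (\<chi> h a) = c g h \<otimes>\<^bsub>K\<^esub> \<chi> (g \<otimes>\<^bsub>G\<^esub> h) a \<otimes>\<^bsub>K\<^esub> inv\<^bsub>K\<^esub> (c g h)"
      using fs that by (auto simp: factor_system_def)
    moreover have "c g h \<in> Units K" using c[OF g h] K.skew_field_Units by blast
    ultimately show ?thesis
      using chiK[of "g \<otimes>\<^bsub>G\<^esub> h" a] g h a by (simp add: K.m_assoc K.Units_closed K.Units_l_inv)
  qed
  have cocycle: "c g h \<otimes>\<^bsub>K\<^esub> c (g \<otimes>\<^bsub>G\<^esub> h) k = \<chi> g (c h k) \<otimes>\<^bsub>K\<^esub> c g (h \<otimes>\<^bsub>G\<^esub> k)"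
    if "g \<in> carrier G" "h \<in> carrier G" "k \<in> carrier G" for g h k
    using fs that by (auto simp: factor_system_def)
  have car: "f p \<in> carrier K" if "f \<in> carrier V" for f p
    using that unfolding V_def mem_free_module by blast
  have closed: "?\<rho> g f \<in> carrier V" if g: "g \<in> carrier G" and f: "f \<in> carrier V" for g f
    unfolding V_def
  proof (rule K.free_module_supportI)
    let ?S = "(\<lambda>(h, i). (g \<otimes>\<^bsub>G\<^esub> h, i)) ` {p. f p \<noteq> \<zero>\<^bsub>K\<^esub>}"
    show "?\<rho> g f p \<in> carrier K" for p
      using g car[OF f] cK chiK by (cases p) (simp add: twisted_translation_def)
    show "{p. ?\<rho> g f p \<noteq> \<zero>\<^bsub>K\<^esub>} \<subseteq> ?S"
    proof clarify
      fix k i assume nz: "?\<rho> g f (k, i) \<noteq> \<zero>\<^bsub>K\<^esub>"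
      then have k: "k \<in> carrier G" by (auto simp: twisted_translation_def split: if_splits)
      have "f (inv\<^bsub>G\<^esub> g \<otimes>\<^bsub>G\<^esub> k, i) \<noteq> \<zero>\<^bsub>K\<^esub>"
        using nz k g K.auto_zero[OF chi[OF g]] cK by (auto simp: twisted_translation_def)
      moreover have "k = g \<otimes>\<^bsub>G\<^esub> (inv\<^bsub>G\<^esub> g \<otimes>\<^bsub>G\<^esub> k)"
        using g k by (simp add: G.m_assoc[symmetric])
      ultimately show "(k, i) \<in> ?S" by (force simp: image_iff)
    qed
    show "finite ?S" "?S \<subseteq> carrier G \<times> {..<n}"
      using f g by (auto simp: V_def mem_free_module)
  qed
  have "semilinear K V (\<chi> g) (?\<rho> g)" if g: "g \<in> carrier G" for g
    unfolding semilinear_def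
  proof (intro conjI ballI)
    have hom: "\<chi> g (x \<oplus>\<^bsub>K\<^esub> y) = \<chi> g x \<oplus>\<^bsub>K\<^esub> \<chi> g y" if "x \<in> carrier K" "y \<in> carrier K" for x y
      using ring_iso_memE(3)[OF chi[OF g]] that by blast
    fix f f' assume f: "f \<in> carrier V" "f' \<in> carrier V"
    show "?\<rho> g (f \<oplus>\<^bsub>V\<^esub> f') = ?\<rho> g f \<oplus>\<^bsub>V\<^esub> ?\<rho> g f'"
      using g f car hom chiK cK
      by (auto simp: V_def twisted_translation_def fun_eq_iff K.l_distr)
  next
    fix a f assume a: "a \<in> carrier K" and f: "f \<in> carrier V"
    show "?\<rho> g (a \<odot>\<^bsub>V\<^esub> f) = \<chi> g a \<odot>\<^bsub>V\<^esub> ?\<rho> g f"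
      using g a car[OF f] ring_isoD(2)[OF chi[OF g] a] chiK cK
      by (auto simp: V_def twisted_translation_def fun_eq_iff K.m_assoc)
  qed (use chi[OF g] closed[OF g] in auto)
  moreover have "?\<rho> g (?\<rho> h f) = c g h \<odot>\<^bsub>V\<^esub> ?\<rho> (g \<otimes>\<^bsub>G\<^esub> h) f"
    if g: "g \<in> carrier G" and h: "h \<in> carrier G" and f: "f \<in> carrier V" for g h f
  proof -
    have "?\<rho> g (?\<rho> h f) (k, i) = c g h \<otimes>\<^bsub>K\<^esub> ?\<rho> (g \<otimes>\<^bsub>G\<^esub> h) f (k, i)" if k: "k \<in> carrier G" for k i
    proof -
      \<comment> \<open>Both sides read off the coefficient of \<open>f\<close> at the \<open>m\<close> with \<open>g h m = k\<close>.\<close>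
      define m where "m = inv\<^bsub>G\<^esub> h \<otimes>\<^bsub>G\<^esub> (inv\<^bsub>G\<^esub> g \<otimes>\<^bsub>G\<^esub> k)"
      have m: "m \<in> carrier G" "h \<otimes>\<^bsub>G\<^esub> m = inv\<^bsub>G\<^esub> g \<otimes>\<^bsub>G\<^esub> k"
        "inv\<^bsub>G\<^esub> (g \<otimes>\<^bsub>G\<^esub> h) \<otimes>\<^bsub>G\<^esub> k = m"
        using g h k by (simp_all add: m_def G.inv_mult_group G.m_assoc) (simp add: G.m_assoc[symmetric])
      define a where "a = f (m, i)"
      have a: "a \<in> carrier K" using car[OF f] by (simp add: a_def)
      note K_car = a g h m(1) chiK cK
      have "?\<rho> g (?\<rho> h f) (k, i) = \<chi> g (\<chi> h a \<otimes>\<^bsub>K\<^esub> c h m) \<otimes>\<^bsub>K\<^esub> c g (h \<otimes>\<^bsub>G\<^esub> m)"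
        using g h k m(2) by (simp add: twisted_translation_def a_def m_def)
      also have "\<dots> = \<chi> g (\<chi> h a) \<otimes>\<^bsub>K\<^esub> (\<chi> g (c h m) \<otimes>\<^bsub>K\<^esub> c g (h \<otimes>\<^bsub>G\<^esub> m))"
        using K_car ring_isoD(2)[OF chi[OF g]] by (simp add: K.m_assoc)
      also have "\<dots> = \<chi> g (\<chi> h a) \<otimes>\<^bsub>K\<^esub> c g h \<otimes>\<^bsub>K\<^esub> c (g \<otimes>\<^bsub>G\<^esub> h) m"
        using K_car cocycle[OF g h m(1)] by (simp add: K.m_assoc)
      also have "\<dots> = c g h \<otimes>\<^bsub>K\<^esub> (\<chi> (g \<otimes>\<^bsub>G\<^esub> h) a \<otimes>\<^bsub>K\<^esub> c (g \<otimes>\<^bsub>G\<^esub> h) m)"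
        using K_car conj[OF g h a] by (simp add: K.m_assoc)
      also have "\<dots> = c g h \<otimes>\<^bsub>K\<^esub> ?\<rho> (g \<otimes>\<^bsub>G\<^esub> h) f (k, i)"
        using k m(3) by (simp add: twisted_translation_def a_def)
      finally show ?thesis .
    qed
    moreover have "?\<rho> g (?\<rho> h f) (k, i) = c g h \<otimes>\<^bsub>K\<^esub> ?\<rho> (g \<otimes>\<^bsub>G\<^esub> h) f (k, i)"
      if k: "k \<notin> carrier G" for k i
      using k cK[OF g h] by (simp add: twisted_translation_def)
    ultimately show ?thesis by (auto simp: V_def fun_eq_iff)
  qed
  ultimately show "rep_associated K G V ?\<rho> \<chi> c"
    unfolding rep_associated_def by simp
  show "?\<rho> \<one>\<^bsub>G\<^esub> f = f" if f: "f \<in> carrier V"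
  proof (rule ext, clarify)
    fix k i
    have "f (k, i) = \<zero>\<^bsub>K\<^esub>" if "k \<notin> carrier G"
      using f that unfolding V_def mem_free_module by blast
    then show "?\<rho> \<one>\<^bsub>G\<^esub> f (k, i) = f (k, i)"
      using factor_system_normalized[OF K G fs] car[OF f] by (simp add: twisted_translation_def)
  qed
qed


section \<open>Lattices over a division ring and extensions\<close>

theorem theorem4:
  fixes K :: "('k, 'm) ring_scheme" and G :: "('g, 'h) monoid_scheme"
  assumes "skew_field K" and "group G"
  shows "(\<forall>(V :: ('k, 'v) module) act.
            G_lattice_over K G V act \<and> (\<forall>g \<in> carrier G. coordinatizable K V (act g)) \<longrightarrow>
              (\<exists>\<chi> c. factor_system K G \<chi> c \<and> extension_determined K G V act (extension K G \<chi> c)) \<and>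
              (\<forall>\<chi> c \<chi>' c'.
                 factor_system K G \<chi> c \<and> factor_system K G \<chi>' c' \<and>
                 extension_determined K G V act (extension K G \<chi> c) \<and>
                 extension_determined K G V act (extension K G \<chi>' c') \<longrightarrow>
                   factor_systems_equivalent K G \<chi> c \<chi>' c')) \<and>
         (\<forall>\<chi> c. factor_system K G \<chi> c \<longrightarrow>
            (\<exists>(V :: ('k, 'g \<times> nat \<Rightarrow> 'k) module) act.
               G_lattice_over K G V act \<and> (\<forall>g \<in> carrier G. coordinatizable K V (act g)) \<and>
               extension_determined K G V act (extension K G \<chi> c)))"
proof (intro conjI allI impI)
  interpret K: skew_field K by fact
  fix V :: "('k, 'v) module" and act
  assume L: "G_lattice_over K G V act \<and> (\<forall>g \<in> carrier G. coordinatizable K V (act g))"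
  then have V: "left_module K V" and rank: "rank_at_least K V 2"
    and act: "G_lattice G (submodule_lattice K V) act"
    using rank_at_least_mono[of K V 3 2] unfolding G_lattice_over_def by auto
  interpret V: skew_module K V
    using \<open>skew_field K\<close> V by (rule skew_module.intro)
  note det_iff = extension_determined_iff[OF assms, of _ _ V act]
  show "\<exists>\<chi> c. factor_system K G \<chi> c \<and> extension_determined K G V act (extension K G \<chi> c)"
    using V.lattice_determines_rep[OF \<open>group G\<close> rank act] L det_iff by metis
  fix \<chi> c \<chi>' c'
  assume fs: "factor_system K G \<chi> c \<and> factor_system K G \<chi>' c' \<and>
    extension_determined K G V act (extension K G \<chi> c) \<and>
    extension_determined K G V act (extension K G \<chi>' c')"
  then obtain \<rho> \<rho>' where
    "semilinear_rep K G V \<rho>" "rep_determines K G V \<rho> act" "rep_associated K G V \<rho> \<chi> c"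
    "semilinear_rep K G V \<rho>'" "rep_determines K G V \<rho>' act" "rep_associated K G V \<rho>' \<chi>' c'"
    using det_iff by blast
  then show "factor_systems_equivalent K G \<chi> c \<chi>' c'"
    using V.lattice_reps_equivalent[OF \<open>group G\<close> rank] fs by blast
next
  interpret K: skew_field K by fact
  interpret G: group G by fact
  fix \<chi> c assume fs: "factor_system K G \<chi> c"
  let ?I = "carrier G \<times> {..<3 :: nat}"
  let ?V = "free_module K ?I" and ?\<rho> = "twisted_translation K G \<chi> c"
  let ?act = "\<lambda>g W. ?\<rho> g ` W"
  have V: "left_module K ?V" by (rule K.free_module_left_module)
  interpret V: skew_module K ?V
    using \<open>skew_field K\<close> V by (rule skew_module.intro)
  have "infinite ?I \<or> 3 \<le> card ?I"
  proof (cases "finite (carrier G)")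
    case True
    then have "1 \<le> card (carrier G)"
      using G.one_closed by (metis One_nat_def Suc_leI card_gt_0_iff empty_iff)
    then show ?thesis by (simp add: card_cartesian_product)
  next
    case False
    have "(3 :: nat) \<noteq> 0" by simp
    then have "{..<3 :: nat} \<noteq> {}" by blast
    with False show ?thesis using finite_cartesian_productD1 by blast
  qed
  then have rank: "rank_at_least K ?V 3"
    using V.one_nonzero by (intro K.free_module_rank) auto
  note rep = twisted_translation_rep[where n = 3, OF assms fs]
  note lat = V.lattice_of_rep[OF \<open>group G\<close> fs rep]
  show "\<exists>(V :: ('k, 'g \<times> nat \<Rightarrow> 'k) module) act.
      G_lattice_over K G V act \<and> (\<forall>g \<in> carrier G. coordinatizable K V (act g)) \<and>
      extension_determined K G V act (extension K G \<chi> c)"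
  proof (intro exI[of _ ?V] exI[of _ ?act] conjI ballI)
    show "G_lattice_over K G ?V ?act"
      unfolding G_lattice_over_def using V rank lat(1) by blast
  qed (rule lat; assumption)+
qed

end
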